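(* Let $(X,\|\cdot\|)$ be a Banach space. Then the following assertions are mutually equivalent. (i) $X$ is an Asplund space. (ii) $X$ admits an Asplund generator. (iii) There exists a rich rectangle-family $\mathcal A\subset\mathcal S_{\square}(X\times X^* )$ such that $Y_1\subset Y_2$ whenever $V_1\times Y_1,\ V_2\times Y_2$ are in $\mathcal A$ and $V_1\subset V_2$, and such that for every $V\times Y\in\mathcal A$ the assignment $Y\ni x^*\longmapsto x^*|_V\in V^*$ is a surjective isometry. (iv) There exists a cofinal rectangle-family $\mathcal A\subset\mathcal S_{\square}(X\times X^* )$ such that for every $V\times Y\in\mathcal A$ the assignment $Y\ni x^*\longmapsto x^*|_V\in V^*$ is a surjection.
   Context: A Banach space is Asplund if every convex continuous function on it is Fréchet differentiable at some point (equivalently, every separable subspace of it has separable dual). For a Banach space $Z$, $\mathcal S(Z)$ is the family of all separable closed subspaces of $Z$ and $\mathcal C(Z)$ the family of all countable subsets of $Z$. $\overline{\rm sp}$ denotes closed linear span. For $A\subset X$ and $B\subset X^*$, $B|_A:=\{x^*|_A:\ x^*\in B\}$. $\mathcal S_{\square}(X\times X^* )$ is the family of all rectangles $V\times Y$ with $V\in\mathcal S(X)$, $Y\in\mathcal S(X^* )$, ordered by inclusion. Any subset $\mathcal R$ of it is called a rectangle-family. $\mathcal R$ is cofinal if every element of $\mathcal S_{\square}(X\times X^* )$ is contained in some element of $\mathcal R$. It is $\sigma$-complete if for every increasing sequence $V_1\times Y_1\subset V_2\times Y_2\subset\cdots$ in $\mathcal R$ its supremum $\overline{\bigcup_i V_i}\times\overline{\bigcup_i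 Y_i}$ belongs to $\mathcal R$. It is rich if it is both cofinal and $\sigma$-complete. An Asplund generator in $X$ is a map $G:\mathcal C(X)\to\mathcal C(X^* )$ such that: (a) $(\overline{\rm sp}\,C)^*\subset\overline{G(C)|_{\overline{\rm sp}\,C}}$ (norm closure in $(\overline{\rm sp}\,C)^*$) for every $C\in\mathcal C(X)$; (b) if $C_1,C_2,\ldots$ is an increasing sequence in $\mathcal C(X)$, then $G(C_1\cup C_2\cup\cdots)=G(C_1)\cup G(C_2)\cup\cdots$; (c) $\bigcup\{G(C):\ C\in\mathcal C(X)\}$ is dense in $X^*$; (d) if $C_1,C_2\in\mathcal C(X)$ satisfy $\overline{\rm sp}\,C_1=\overline{\rm sp}\,C_2$, then $\overline{\rm sp}\,G(C_1)=\overline{\rm sp}\,G(C_2)$. *)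

theory Defs
  imports "HOL-Analysis.Analysis"
begin

text \<open>The Banach space \<open>X\<close> is a type \<open>'a :: banach\<close> and its dual is the Banach space
  \<open>'a \<Rightarrow>\<^sub>L real\<close> with the operator norm.\<close>

text \<open>\<^const>\<open>differentiable\<close> is Frechet differentiability: the derivative is a bounded linear map.\<close>

definition asplund_space :: "'a::banach itself \<Rightarrow> bool" where
  "asplund_space _ \<longleftrightarrow>
     (\<forall>f::'a \<Rightarrow> real. convex_on UNIV f \<and> continuous_on UNIV f \<longrightarrow> (\<exists>x. f differentiable (at x)))"

definition closed_span :: "'a::real_normed_vector set \<Rightarrow> 'a set" where
  "closed_span A = closure (span A)"

definition separable_closed_subspaces :: "'a::real_normed_vector set set" where
  "separable_closed_subspaces = {V. subspace V \<and> closed V \<and> separable_space (top_of_set V)}"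

text \<open>Since a subspace \<open>V\<close> is a set and not a type, its dual consists of functions on \<open>V\<close>,
  represented extensionally (\<^const>\<open>undefined\<close> outside \<open>V\<close>), so that equality in
  \<open>subspace_dual V\<close> is equality on \<open>V\<close>.\<close>

definition subspace_dual :: "'a::real_normed_vector set \<Rightarrow> ('a \<Rightarrow> real) set" where
  "subspace_dual V = {f \<in> extensional V.
     (\<forall>x\<in>V. \<forall>y\<in>V. f (x + y) = f x + f y) \<and>
     (\<forall>c. \<forall>x\<in>V. f (c *\<^sub>R x) = c * f x) \<and>
     (\<exists>K. \<forall>x\<in>V. \<bar>f x\<bar> \<le> K * norm x)}"

definition subspace_dual_dist ::
    "'a::real_normed_vector set \<Rightarrow> ('a \<Rightarrow> real) \<Rightarrow> ('a \<Rightarrow> real) \<Rightarrow> real" where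
  "subspace_dual_dist V f g = (SUP x\<in>V \<inter> cball 0 1. \<bar>f x - g x\<bar>)"

definition subspace_dual_closure ::
    "'a::real_normed_vector set \<Rightarrow> ('a \<Rightarrow> real) set \<Rightarrow> ('a \<Rightarrow> real) set" where
  "subspace_dual_closure V S =
     {f \<in> subspace_dual V. \<forall>e>0. \<exists>g\<in>S. subspace_dual_dist V g f < e}"

definition restrict_functional ::
    "'a::real_normed_vector set \<Rightarrow> ('a \<Rightarrow>\<^sub>L real) \<Rightarrow> ('a \<Rightarrow> real)" where
  "restrict_functional V f = restrict (blinfun_apply f) V"

lemma restrict_functional_in_subspace_dual:
  assumes "subspace V"
  shows "restrict_functional V f \<in> subspace_dual V"
proof -
  have "\<forall>x\<in>V. \<bar>restrict_functional V f x\<bar> \<le> norm f * norm x"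
    using norm_blinfun[of f] by (simp add: restrict_functional_def)
  then show ?thesis
    using assms
    by (auto simp: subspace_dual_def restrict_functional_def blinfun.add_right
        blinfun.scaleR_right subspace_add subspace_scale)
qed

definition separable_rectangles ::
    "('a::real_normed_vector \<times> ('a \<Rightarrow>\<^sub>L real)) set set" where
  "separable_rectangles =
     {V \<times> Y |V Y. V \<in> separable_closed_subspaces \<and> Y \<in> separable_closed_subspaces}"

definition rectangle_family ::
    "('a::real_normed_vector \<times> ('a \<Rightarrow>\<^sub>L real)) set set \<Rightarrow> bool" where
  "rectangle_family R \<longleftrightarrow> R \<subseteq> separable_rectangles"

definition cofinal_family ::
    "('a::real_normed_vector \<times> ('a \<Rightarrow>\<^sub>L real)) set set \<Rightarrow> bool" where
  "cofinal_family R \<longleftrightarrow> (\<forall>W\<in>separable_rectangles. \<exists>W'\<in>R. W \<subseteq> W')"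

definition sigma_complete_family ::
    "('a::real_normed_vector \<times> ('a \<Rightarrow>\<^sub>L real)) set set \<Rightarrow> bool" where
  "sigma_complete_family R \<longleftrightarrow>
     (\<forall>(V :: nat \<Rightarrow> 'a set) (Y :: nat \<Rightarrow> ('a \<Rightarrow>\<^sub>L real) set).
        (\<forall>i. V i \<times> Y i \<in> R) \<and> (\<forall>i. V i \<times> Y i \<subseteq> V (Suc i) \<times> Y (Suc i)) \<longrightarrow>
        closure (\<Union>i. V i) \<times> closure (\<Union>i. Y i) \<in> R)"

definition rich_family ::
    "('a::real_normed_vector \<times> ('a \<Rightarrow>\<^sub>L real)) set set \<Rightarrow> bool" where
  "rich_family R \<longleftrightarrow> cofinal_family R \<and> sigma_complete_family R"

text \<open>A map from countable subsets of \<open>X\<close> to countable subsets of the dual is given by a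
  function on all sets; its values on uncountable sets play no role.\<close>

definition asplund_generator ::
    "('a::banach set \<Rightarrow> ('a \<Rightarrow>\<^sub>L real) set) \<Rightarrow> bool" where
  "asplund_generator G \<longleftrightarrow>
     (\<forall>C. countable C \<longrightarrow> countable (G C)) \<and>
     (\<forall>C. countable C \<longrightarrow>
        subspace_dual (closed_span C) \<subseteq>
        subspace_dual_closure (closed_span C) (restrict_functional (closed_span C) ` G C)) \<and>
     (\<forall>C :: nat \<Rightarrow> 'a set. (\<forall>i. countable (C i)) \<and> (\<forall>i. C i \<subseteq> C (Suc i)) \<longrightarrow>
        G (\<Union>i. C i) = (\<Union>i. G (C i))) \<and>
     closure (\<Union>{G C |C. countable C}) = UNIV \<and>
     (\<forall>C1 C2. countable C1 \<and> countable C2 \<and> closed_span C1 = closed_span C2 \<longrightarrow>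
        closed_span (G C1) = closed_span (G C2))"

definition restriction_surjective ::
    "'a::real_normed_vector set \<Rightarrow> ('a \<Rightarrow>\<^sub>L real) set \<Rightarrow> bool" where
  "restriction_surjective V Y \<longleftrightarrow> restrict_functional V ` Y = subspace_dual V"

definition restriction_isometric ::
    "'a::real_normed_vector set \<Rightarrow> ('a \<Rightarrow>\<^sub>L real) set \<Rightarrow> bool" where
  "restriction_isometric V Y \<longleftrightarrow>
     (\<forall>y1\<in>Y. \<forall>y2\<in>Y.
        subspace_dual_dist V (restrict_functional V y1) (restrict_functional V y2) = dist y1 y2)"

end

theory Submission
  imports Defs
begin

text \<open>The implications form a cycle.

  From an Asplund space to a generator: differentiability of support functions makes bounded sets of
  functionals fragmented by the norm in the weak* topology. Peeling a dual ball transfinitely into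
  small relatively open pieces ranks its points so that every weak* closed set attains a maximal rank,
  on a small set of points; picking one point per rank gives a selector on weak* closed sets. Maximal
  ranks, being well-ordered, stabilise along filtered families of compact sets. So the values of the
  selector on the sets cut out of the ball by finitely many inequalities \<open>y x \<le> q\<close>, with \<open>q\<close>
  rational and \<open>x\<close> in the rational span of \<open>C\<close>, approximate every functional on the closed span of
  \<open>C\<close>; and since they do not change when the \<open>q\<close> are slightly increased, they only depend on that
  closed span.

  From a generator to a rich family: take the rectangles \<open>closed_span C \<times> closed_span (G C)\<close> on which
  restriction is isometric. Adding norming points of the functionals to \<open>C\<close> over and over makes such
  rectangles cofinal, and isometry turns density of the restrictions into surjectivity.

  From a cofinal family back to Asplund: if a convex continuous function is nowhere differentiable,
  then, by Baire, a selection of its subdifferential oscillates by more than some fixed amount on all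
  open subsets of some ball, and this is witnessed inside a separable subspace. A second application of
  Baire, together with monotonicity of the subdifferential, contradicts separability of the dual of
  that subspace.\<close>

subsection \<open>The Hahn--Banach theorem\<close>

text \<open>Homogeneity is asked for as an inequality for positive scalars, which is what infima
  deliver directly; applying it to the inverse scalar gives equality in
  \<open>sublinear_scale\<close>.\<close>

definition sublinear :: "('a::real_vector \<Rightarrow> real) \<Rightarrow> bool" where
  "sublinear p \<longleftrightarrow> (\<forall>x y. p (x + y) \<le> p x + p y) \<and> (\<forall>c x. c > 0 \<longrightarrow> p (c *\<^sub>R x) \<le> c * p x)"

lemma sublinear_add: "sublinear p \<Longrightarrow> p (x + y) \<le> p x + p y"
  by (simp add: sublinear_def)

lemma sublinear_scale:
  assumes p: "sublinear p" and c: "c > 0"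
  shows "p (c *\<^sub>R x) = c * p x"
proof (rule antisym)
  show "p (c *\<^sub>R x) \<le> c * p x"
    using p c by (simp add: sublinear_def)
  have "p (inverse c *\<^sub>R (c *\<^sub>R x)) \<le> inverse c * p (c *\<^sub>R x)"
    using p c unfolding sublinear_def by (meson positive_imp_inverse_positive)
  then have "p x \<le> inverse c * p (c *\<^sub>R x)"
    using c by simp
  then show "c * p x \<le> p (c *\<^sub>R x)"
    using c by (simp add: field_simps)
qed

lemma sublinear_zero: "sublinear p \<Longrightarrow> p 0 = 0"
  using sublinear_scale[of p 2 0] by simp

lemma sublinear_minus: "sublinear p \<Longrightarrow> - p (- x) \<le> p x"
  using sublinear_add[of p x "- x"] sublinear_zero[of p] by simp

text \<open>The common pattern of the constructions below: chains of sublinear functionals, the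
  extension of a functional and the directional derivative are all pointwise infima of sets
  \<open>S x\<close> of candidate values that can be added and rescaled.\<close>

lemma sublinear_Inf:
  fixes S :: "'a::real_vector \<Rightarrow> real set"
  assumes ne: "\<And>x. S x \<noteq> {}" and bdd: "\<And>x. bdd_below (S x)"
    and add: "\<And>x y a b. a \<in> S x \<Longrightarrow> b \<in> S y \<Longrightarrow> \<exists>c\<in>S (x + y). c \<le> a + b"
    and scale: "\<And>x a c. a \<in> S x \<Longrightarrow> c > 0 \<Longrightarrow> c * a \<in> S (c *\<^sub>R x)"
  shows "sublinear (\<lambda>x. Inf (S x))"
  unfolding sublinear_def
proof (intro conjI allI impI)
  fix x y
  have "Inf (S (x + y)) - b \<le> Inf (S x)" if b: "b \<in> S y" for b
  proof (rule cInf_greatest[OF ne])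
    fix a assume "a \<in> S x"
    with b obtain c where "c \<in> S (x + y)" "c \<le> a + b"
      using add by blast
    then show "Inf (S (x + y)) - b \<le> a"
      using cInf_lower[OF _ bdd, of c "x + y"] by simp
  qed
  then have "Inf (S (x + y)) - Inf (S x) \<le> Inf (S y)"
    by (intro cInf_greatest[OF ne]) (simp add: algebra_simps)
  then show "Inf (S (x + y)) \<le> Inf (S x) + Inf (S y)" by simp
next
  fix c :: real and x :: 'a
  assume c: "c > 0"
  have "Inf (S (c *\<^sub>R x)) / c \<le> Inf (S x)"
  proof (rule cInf_greatest[OF ne])
    fix a assume "a \<in> S x"
    then have "Inf (S (c *\<^sub>R x)) \<le> c * a"
      using scale c bdd cInf_lower by blast
    then show "Inf (S (c *\<^sub>R x)) / c \<le> a"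
      using c by (simp add: field_simps)
  qed
  then show "Inf (S (c *\<^sub>R x)) \<le> c * Inf (S x)"
    using c by (simp add: field_simps)
qed

text \<open>For fixed \<open>y\<close>, the infimum over \<open>t \<ge> 0\<close> of
  \<open>q (x + t y) - t q y\<close> is sublinear in \<open>x\<close> and at most \<open>q\<close>,
  hence equal to \<open>q\<close>. Its value at \<open>- y\<close> is at most \<open>- q y\<close>,
  by \<open>t = 1\<close>. So \<open>q\<close> is odd, and an odd sublinear functional is
  linear.\<close>

lemma minimal_sublinear_linear:
  assumes q: "sublinear q"
    and minimal: "\<And>q'. sublinear q' \<Longrightarrow> q' \<le> q \<Longrightarrow> q' = q"
  shows "linear q"
proof -
  have neg: "q (- y) \<le> - q y" for y
  proof -
    define S where "S x = (\<lambda>t. q (x + t *\<^sub>R y) - t * q y) ` {0..}" for x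
    have S: "a \<in> S x \<longleftrightarrow> (\<exists>t\<ge>0. a = q (x + t *\<^sub>R y) - t * q y)" for a x
      by (auto simp: S_def)
    have ty: "q (t *\<^sub>R y) = t * q y" if "t \<ge> 0" for t
      using that sublinear_scale[OF q, of t y] sublinear_zero[OF q] by (cases "t = 0") auto
    have lower: "- q (- x) \<le> a" if a: "a \<in> S x" for a x
    proof -
      obtain t where t: "t \<ge> 0" "a = q (x + t *\<^sub>R y) - t * q y"
        using a S by blast
      have "q (t *\<^sub>R y) \<le> q (x + t *\<^sub>R y) + q (- x)"
        using sublinear_add[OF q, of "x + t *\<^sub>R y" "- x"] by simp
      then show ?thesis using t ty by simp
    qed
    have bdd: "bdd_below (S x)" for x
      using lower by (meson bdd_belowI)
    have sub: "sublinear (\<lambda>x. Inf (S x))"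
    proof (rule sublinear_Inf)
      show "S x \<noteq> {}" for x by (auto simp: S_def)
      show "\<exists>c\<in>S (x + z). c \<le> a + b" if "a \<in> S x" "b \<in> S z" for x z a b
      proof -
        obtain t s where t: "t \<ge> 0" "a = q (x + t *\<^sub>R y) - t * q y"
          and s: "s \<ge> 0" "b = q (z + s *\<^sub>R y) - s * q y"
          using \<open>a \<in> S x\<close> \<open>b \<in> S z\<close> S by blast
        have "q (x + z + (t + s) *\<^sub>R y) \<le> q (x + t *\<^sub>R y) + q (z + s *\<^sub>R y)"
          using sublinear_add[OF q, of "x + t *\<^sub>R y" "z + s *\<^sub>R y"] by (simp add: algebra_simps)
        then have "q (x + z + (t + s) *\<^sub>R y) - (t + s) * q y \<le> a + b"
          using t s by (simp add: algebra_simps)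
        moreover have "q (x + z + (t + s) *\<^sub>R y) - (t + s) * q y \<in> S (x + z)"
          unfolding S using t s by (intro exI[of _ "t + s"]) simp
        ultimately show ?thesis by blast
      qed
      show "c * a \<in> S (c *\<^sub>R x)" if "a \<in> S x" "c > 0" for x a c
      proof -
        obtain t where t: "t \<ge> 0" "a = q (x + t *\<^sub>R y) - t * q y"
          using \<open>a \<in> S x\<close> S by blast
        have "c * a = q (c *\<^sub>R x + (c * t) *\<^sub>R y) - (c * t) * q y"
          using sublinear_scale[OF q \<open>c > 0\<close>, of "x + t *\<^sub>R y"] t
          by (simp add: right_diff_distrib scaleR_add_right)
        then show ?thesis
          unfolding S using t \<open>c > 0\<close> by (intro exI[of _ "c * t"]) simp
      qed
    qed (rule bdd)
    have "Inf (S x) \<le> q x" for x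
      by (rule cInf_lower[OF _ bdd]) (auto simp: S intro!: exI[of _ 0])
    then have eq: "(\<lambda>x. Inf (S x)) = q"
      using minimal[OF sub] by (simp add: le_fun_def)
    have "Inf (S (- y)) \<le> - q y"
      by (rule cInf_lower[OF _ bdd]) (auto simp: S sublinear_zero[OF q] intro!: exI[of _ 1])
    then show ?thesis using eq by metis
  qed
  then have odd: "q (- y) = - q y" for y
    using sublinear_minus[OF q, of "- y"] neg[of y] by simp
  show ?thesis
  proof (rule linearI)
    show "q (x + y) = q x + q y" for x y
      using sublinear_add[OF q, of x y] sublinear_add[OF q, of "- x" "- y"] odd
      by (simp add: odd[of "x + y", simplified])
    show "q (c *\<^sub>R x) = c *\<^sub>R q x" for c x
      using sublinear_scale[OF q, of c x] sublinear_scale[OF q, of "- c" x] odd[of "c *\<^sub>R x"]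
        sublinear_zero[OF q]
      by (cases "c > 0"; cases "c = 0") auto
  qed
qed

text \<open>Zorn's lemma yields a minimal sublinear functional below \<open>p\<close>, and minimal
  ones are linear. Chains have their pointwise infimum as lower bound; it is finite because every
  sublinear \<open>q \<le> p\<close> satisfies \<open>- p (- x) \<le> q x\<close>.\<close>

lemma sublinear_dominates_linear:
  assumes p: "sublinear p"
  obtains g where "linear g" "\<And>x. g x \<le> p x"
proof -
  define Q where "Q = {q. sublinear q \<and> q \<le> p}"
  have lower: "- p (- x) \<le> q x" if "q \<in> Q" for q x
    using that sublinear_minus[of q x] by (force simp: Q_def le_fun_def dest: spec[of _ "- x"])
  have "\<exists>m\<in>Q. \<forall>q\<in>Q. q \<le> m \<longrightarrow> q = m"
  proof (rule predicate_Zorn)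
    show "partial_order_on Q (relation_of (\<lambda>x y. y \<le> x) Q)"
      by (rule partial_order_on_relation_ofI) auto
    fix C assume C: "C \<in> Chains (relation_of (\<lambda>x y. y \<le> x) Q)"
    then have CQ: "C \<subseteq> Q" and chain: "\<And>q q'. q \<in> C \<Longrightarrow> q' \<in> C \<Longrightarrow> q \<le> q' \<or> q' \<le> q"
      by (auto simp: Chains_def relation_of_def)
    show "\<exists>u\<in>Q. \<forall>q\<in>C. u \<le> q"
    proof (cases "C = {}")
      case True
      then show ?thesis using p by (auto simp: Q_def)
    next
      case False
      define S where "S x = (\<lambda>q. q x) ` C" for x
      have bdd: "bdd_below (S x)" for x
        using lower CQ by (auto simp: S_def intro!: bdd_belowI2[of _ "- p (- x)"])
      have sub: "sublinear (\<lambda>x. Inf (S x))"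
      proof (rule sublinear_Inf)
        show "\<exists>c\<in>S (x + y). c \<le> a + b" if ab: "a \<in> S x" "b \<in> S y" for x y a b
        proof -
          obtain q q' where q: "q \<in> C" "a = q x" "q' \<in> C" "b = q' y"
            using ab by (auto simp: S_def)
          then obtain r where r: "r \<in> C" "r \<le> q" "r \<le> q'"
            using chain by blast
          then have "r (x + y) \<le> r x + r y"
            using CQ by (auto simp: Q_def sublinear_add)
          also have "\<dots> \<le> a + b"
            using r q by (auto simp: le_fun_def intro: add_mono)
          finally show ?thesis using r by (auto simp: S_def)
        qed
        show "c * a \<in> S (c *\<^sub>R x)" if "a \<in> S x" "c > 0" for x a c
        proof -
          obtain q where q: "q \<in> C" "a = q x"
            using \<open>a \<in> S x\<close> by (auto simp: S_def)
          then have "q (c *\<^sub>R x) = c * a"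
            using sublinear_scale[of q c x] \<open>c > 0\<close> CQ by (auto simp: Q_def)
          then show ?thesis using q by (auto simp: S_def intro: rev_image_eqI)
        qed
      qed (use False bdd in \<open>auto simp: S_def\<close>)
      have le: "Inf (S x) \<le> q x" if "q \<in> C" for q x
        by (rule cInf_lower[OF _ bdd]) (use that in \<open>auto simp: S_def\<close>)
      obtain q where "q \<in> C" using False by blast
      then have "q \<le> p" "(\<lambda>x. Inf (S x)) \<le> q"
        using le CQ by (auto simp: Q_def le_fun_def)
      then have "(\<lambda>x. Inf (S x)) \<in> Q"
        using sub order_trans by (auto simp: Q_def)
      with le show ?thesis
        by (intro bexI[of _ "\<lambda>x. Inf (S x)"]) (auto simp: le_fun_def)
    qed
  qed
  then obtain m where m: "m \<in> Q" "\<And>q. q \<in> Q \<Longrightarrow> q \<le> m \<Longrightarrow> q = m"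
    by blast
  have "linear m"
    by (rule minimal_sublinear_linear) (use m in \<open>auto simp: Q_def\<close>)
  then show thesis
    using that m by (auto simp: Q_def le_fun_def)
qed

text \<open>Hahn--Banach extension. A linear minorant of the infimal convolution of
  \<open>K * norm\<close> with \<open>f\<close> on \<open>V\<close> is bounded by
  \<open>K * norm\<close> (take \<open>v = 0\<close>) and lies below \<open>f\<close> on
  \<open>V\<close> (take \<open>v = x\<close>); applied to \<open>- v\<close>, the latter forces
  equality on \<open>V\<close>.\<close>

lemma restrict_functional_onto:
  fixes V :: "'a::real_normed_vector set"
  assumes V: "subspace V" and f: "f \<in> subspace_dual V"
  obtains y where "restrict_functional V y = f"
proof -
  have f_add: "f (x + y) = f x + f y" if "x \<in> V" "y \<in> V" for x y
    using f that by (simp add: subspace_dual_def)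
  have f_scale: "f (c *\<^sub>R x) = c * f x" if "x \<in> V" for c x
    using f that by (simp add: subspace_dual_def)
  obtain K' where K': "\<And>x. x \<in> V \<Longrightarrow> \<bar>f x\<bar> \<le> K' * norm x"
    using f unfolding subspace_dual_def by blast
  \<comment> \<open>On the zero subspace the given bound may be negative, while
    \<open>K * norm\<close> has to be a seminorm.\<close>
  define K where "K = \<bar>K'\<bar>"
  have K0: "K \<ge> 0" by (simp add: K_def)
  have K: "\<bar>f x\<bar> \<le> K * norm x" if "x \<in> V" for x
    by (rule order_trans[OF K'[OF that]]) (auto simp: K_def intro: mult_right_mono)
  define S where "S x = (\<lambda>v. K * norm (x - v) + f v) ` V" for x
  have S: "a \<in> S x \<longleftrightarrow> (\<exists>v\<in>V. a = K * norm (x - v) + f v)" for a x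
    by (auto simp: S_def)
  have bound: "- K * norm x \<le> K * norm (x - v) + f v" if "v \<in> V" for x v
  proof -
    have "K * norm v \<le> K * (norm x + norm (x - v))"
      using norm_triangle_ineq4[of x "x - v"] K0 by (intro mult_left_mono) auto
    then show ?thesis using K[OF that] by (simp add: algebra_simps)
  qed
  have bdd: "bdd_below (S x)" for x
    using bound by (auto simp: S_def intro!: bdd_belowI2[of _ "- K * norm x"])
  have "sublinear (\<lambda>x. Inf (S x))"
  proof (rule sublinear_Inf)
    show "\<exists>c\<in>S (x + y). c \<le> a + b" if ab: "a \<in> S x" "b \<in> S y" for x y a b
    proof -
      obtain v w where v: "v \<in> V" "a = K * norm (x - v) + f v"
        and w: "w \<in> V" "b = K * norm (y - w) + f w"
        using ab unfolding S by blast
      have "norm (x + y - (v + w)) \<le> norm (x - v) + norm (y - w)"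
        using norm_triangle_ineq[of "x - v" "y - w"] by (simp add: algebra_simps)
      then have "K * norm (x + y - (v + w)) \<le> K * norm (x - v) + K * norm (y - w)"
        using K0 by (metis mult_left_mono distrib_left)
      then have "K * norm (x + y - (v + w)) + f (v + w) \<le> a + b"
        using v w f_add by simp
      moreover have "v + w \<in> V" using v w V by (simp add: subspace_add)
      ultimately show ?thesis by (auto simp: S_def)
    qed
    show "c * a \<in> S (c *\<^sub>R x)" if "a \<in> S x" "c > 0" for x a c
    proof -
      obtain v where v: "v \<in> V" "a = K * norm (x - v) + f v"
        using \<open>a \<in> S x\<close> unfolding S by blast
      have "norm (c *\<^sub>R x - c *\<^sub>R v) = c * norm (x - v)"
        using \<open>c > 0\<close> by (simp flip: scaleR_diff_right)
      then have "c * a = K * norm (c *\<^sub>R x - c *\<^sub>R v) + f (c *\<^sub>R v)"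
        using v f_scale by (simp add: algebra_simps)
      moreover have "c *\<^sub>R v \<in> V" using v V by (simp add: subspace_scale)
      ultimately show ?thesis by (auto simp: S_def)
    qed
  qed (use bdd V subspace_0 in \<open>auto simp: S_def\<close>)
  then obtain g where g: "linear g" "\<And>x. g x \<le> Inf (S x)"
    by (rule sublinear_dominates_linear) blast
  have gK: "g x \<le> K * norm x" for x
  proof -
    have "Inf (S x) \<le> K * norm (x - 0) + f 0"
      by (rule cInf_lower[OF _ bdd]) (use V S subspace_0 in blast)
    then show ?thesis
      using g(2)[of x] f_scale[of 0 0] V by (simp add: subspace_0)
  qed
  have "\<bar>g x\<bar> \<le> K * norm x" for x
    using gK[of x] gK[of "- x"] g(1) by (simp add: linear_neg abs_le_iff)
  then have bl: "bounded_linear g"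
    using g(1) by (intro bounded_linear_intro[of g K])
      (auto simp: linear_add linear_cmul mult.commute)
  have gf: "g v \<le> f v" if "v \<in> V" for v
  proof -
    have "Inf (S v) \<le> K * norm (v - v) + f v"
      by (rule cInf_lower[OF _ bdd]) (use that S in blast)
    then show ?thesis using g(2)[of v] by simp
  qed
  have "g v = f v" if "v \<in> V" for v
  proof -
    have "- g v \<le> - f v"
      using gf[of "- v"] f_scale[OF that, of "-1"] V that g(1) by (simp add: linear_neg subspace_neg)
    then show ?thesis using gf[OF that] by simp
  qed
  moreover have "f \<in> extensional V" using f by (simp add: subspace_dual_def)
  ultimately have "restrict_functional V (Blinfun g) = f"
    using bl by (auto simp: restrict_functional_def fun_eq_iff extensional_def bounded_linear_Blinfun_apply)
  then show thesis by (rule that)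
qed

subsection \<open>Subgradients of continuous convex functions\<close>

text \<open>The one-sided directional derivative at \<open>x\<close>, the infimum of the difference
  quotients over \<open>t > 0\<close>, is sublinear in the direction. A linear minorant of it is a
  subgradient, and continuity of \<open>f\<close> at \<open>x\<close> makes this minorant
  bounded.\<close>

lemma subgradient_exists:
  fixes f :: "'a::real_normed_vector \<Rightarrow> real"
  assumes conv: "convex_on UNIV f" and cont: "continuous_on UNIV f"
  obtains y where "\<And>z. f x + blinfun_apply y (z - x) \<le> f z"
proof -
  define S where "S h = (\<lambda>t. (f (x + t *\<^sub>R h) - f x) / t) ` {0<..}" for h
  have S: "a \<in> S h \<longleftrightarrow> (\<exists>t>0. a = (f (x + t *\<^sub>R h) - f x) / t)" for a h
    by (auto simp: S_def)
  \<comment> \<open>Convexity: the point on the left is the combination of \<open>x + t h\<close>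
    and \<open>x + s k\<close> with weights \<open>s / (t + s)\<close> and
    \<open>t / (t + s)\<close>.\<close>
  have comb: "f (x + (t * s / (t + s)) *\<^sub>R (h + k))
      \<le> s / (t + s) * f (x + t *\<^sub>R h) + t / (t + s) * f (x + s *\<^sub>R k)"
    if "t > 0" "s > 0" for t s h k
  proof -
    define u where "u = t / (t + s)"
    have "t + s \<noteq> 0" using that by linarith
    then have u: "s / (t + s) = 1 - u" "t * s / (t + s) = (1 - u) * t" "u * s = (1 - u) * t"
      by (auto simp: u_def field_simps)
    have u01: "0 \<le> u" "u \<le> 1"
      using that by (auto simp: u_def)
    have "(1 - u) *\<^sub>R (x + t *\<^sub>R h) + u *\<^sub>R (x + s *\<^sub>R k)
        = x + ((1 - u) * t) *\<^sub>R h + (u * s) *\<^sub>R k"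
      by (simp add: algebra_simps)
    also have "\<dots> = x + ((1 - u) * t) *\<^sub>R (h + k)"
      by (simp add: u(3) scaleR_add_right)
    finally show ?thesis
      using convex_onD[OF conv u01, of "x + t *\<^sub>R h" "x + s *\<^sub>R k"]
      unfolding u(1,2) u_def[symmetric] by simp
  qed
  \<comment> \<open>With the step \<open>t * s / (t + s)\<close>, the quotient of the weighted
    average is exactly the sum of the two quotients.\<close>
  have slope_eq: "(a - c) / t + (b - c) / s = (s / (t + s) * a + t / (t + s) * b - c) / (t * s / (t + s))"
    if ts: "t > 0" "s > 0" for a b c t s :: real
  proof -
    have "t + s \<noteq> 0" using ts by linarith
    moreover have "s * (a - c) + t * (b - c) = s * a + t * b - c * (t + s)"
      by (simp add: algebra_simps)
    ultimately have "s / (t + s) * a + t / (t + s) * b - c = (s * (a - c) + t * (b - c)) / (t + s)"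
      by (simp add: diff_divide_distrib add_divide_distrib)
    then have "(s / (t + s) * a + t / (t + s) * b - c) / (t * s / (t + s))
        = (s * (a - c) + t * (b - c)) / (t * s)"
      using \<open>t + s \<noteq> 0\<close> by simp
    also have "\<dots> = (a - c) / t + (b - c) / s"
      using ts by (simp add: add_divide_distrib)
    finally show ?thesis by simp
  qed
  have add: "(f (x + (t * s / (t + s)) *\<^sub>R (h + k)) - f x) / (t * s / (t + s))
      \<le> (f (x + t *\<^sub>R h) - f x) / t + (f (x + s *\<^sub>R k) - f x) / s"
    if ts: "t > 0" "s > 0" for t s h k
  proof -
    have "0 \<le> t * s / (t + s)" using ts by simp
    then show ?thesis
      unfolding slope_eq[OF ts] using comb[OF ts, of h k]
      by (intro divide_right_mono diff_right_mono)
  qed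
  have bdd: "bdd_below (S h)" for h
  proof (rule bdd_belowI)
    fix a assume "a \<in> S h"
    then obtain t where t: "t > 0" "a = (f (x + t *\<^sub>R h) - f x) / t"
      using S by blast
    \<comment> \<open>Subadditivity of the quotients with \<open>k = - h\<close> and
      \<open>s = 1\<close>, where the quotient in direction \<open>h + k = 0\<close>
      vanishes.\<close>
    show "- (f (x - h) - f x) \<le> a"
      using add[of t 1 h "- h"] t by simp
  qed
  have "sublinear (\<lambda>h. Inf (S h))"
  proof (rule sublinear_Inf)
    show "\<exists>c\<in>S (h + k). c \<le> a + b" if ab: "a \<in> S h" "b \<in> S k" for h k a b
    proof -
      obtain t s where ts: "t > 0" "a = (f (x + t *\<^sub>R h) - f x) / t"
          "s > 0" "b = (f (x + s *\<^sub>R k) - f x) / s"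
        using ab unfolding S by blast
      then have "t * s / (t + s) > 0" by simp
      then show ?thesis
        using add[of t s h k] ts S by blast
    qed
    show "c * a \<in> S (c *\<^sub>R h)" if "a \<in> S h" "c > 0" for h a c
    proof -
      obtain t where t: "t > 0" "a = (f (x + t *\<^sub>R h) - f x) / t"
        using \<open>a \<in> S h\<close> unfolding S by blast
      show ?thesis
        unfolding S using t \<open>c > 0\<close> by (intro exI[of _ "t / c"]) auto
    qed
  qed (use bdd in \<open>auto simp: S_def\<close>)
  then obtain g where g: "linear g" "\<And>h. g h \<le> Inf (S h)"
    by (rule sublinear_dominates_linear) blast
  have le: "g h \<le> f (x + h) - f x" for h
  proof -
    have "Inf (S h) \<le> f (x + h) - f x"
      by (rule cInf_lower[OF _ bdd]) (auto simp: S intro!: exI[of _ 1])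
    then show ?thesis using g(2)[of h] by simp
  qed
  obtain d where d: "d > 0" "\<And>z. dist z x < d \<Longrightarrow> dist (f z) (f x) < 1"
    using cont unfolding continuous_on_iff by (metis UNIV_I zero_less_one)
  have "g h \<le> (2 / d) * norm h" for h
  proof (cases "h = 0")
    case True
    then show ?thesis using g(1) by (simp add: linear_0)
  next
    case False
    \<comment> \<open>This rescales \<open>h\<close> to length \<open>d / 2\<close>, inside the ball
      on which \<open>f\<close> differs from \<open>f x\<close> by less than 1.\<close>
    define c where "c = d / (2 * norm h)"
    have c: "c > 0" using False d by (simp add: c_def)
    have "dist (x + c *\<^sub>R h) x < d"
      using False d by (simp add: c_def dist_norm)
    then have "f (x + c *\<^sub>R h) - f x < 1"
      using d(2)[of "x + c *\<^sub>R h"] by (simp add: dist_real_def)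
    then have "c * g h \<le> 1"
      using le[of "c *\<^sub>R h"] g(1) by (simp add: linear_cmul)
    then show ?thesis
      using c False d by (simp add: c_def field_simps)
  qed
  then have "\<bar>g h\<bar> \<le> (2 / d) * norm h" for h
    using g(1) by (metis abs_le_iff linear_neg norm_minus_cancel)
  then have "bounded_linear g"
    using g(1) by (intro bounded_linear_intro[of g "2 / d"])
      (auto simp: linear_add linear_cmul mult.commute)
  then have "f x + blinfun_apply (Blinfun g) (z - x) \<le> f z" for z
    using le[of "z - x"] by (simp add: bounded_linear_Blinfun_apply)
  then show thesis by (rule that)
qed

subsection \<open>Rational spans\<close>

text \<open>A countable substitute for the span: it commutes with increasing unions and has the
  closed span as closure. Indexing combinations by lists makes countability immediate and turns
  addition into concatenation.\<close>

definition rational_span :: "'a::real_vector set \<Rightarrow> 'a set" where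
  "rational_span C = (\<lambda>L. \<Sum>(q, x)\<leftarrow>L. real_of_rat q *\<^sub>R x) ` lists (UNIV \<times> C)"

lemma countable_rational_span: "countable C \<Longrightarrow> countable (rational_span C)"
  unfolding rational_span_def by (intro countable_image countable_lists) simp

lemma rational_span_mono: "C \<subseteq> D \<Longrightarrow> rational_span C \<subseteq> rational_span D"
  unfolding rational_span_def by (intro image_mono lists_mono) auto

lemma rational_span_superset: "C \<subseteq> rational_span C"
proof
  fix x assume "x \<in> C"
  then show "x \<in> rational_span C"
    unfolding rational_span_def by (intro image_eqI[of _ _ "[(1, x)]"]) auto
qed

lemma rational_span_zero: "0 \<in> rational_span C"
  unfolding rational_span_def by (intro image_eqI[of _ _ "[]"]) auto

lemma rational_span_add:
  assumes "x \<in> rational_span C" "y \<in> rational_span C"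
  shows "x + y \<in> rational_span C"
proof -
  obtain L M where "L \<in> lists (UNIV \<times> C)" "x = (\<Sum>(q, x)\<leftarrow>L. real_of_rat q *\<^sub>R x)"
    "M \<in> lists (UNIV \<times> C)" "y = (\<Sum>(q, x)\<leftarrow>M. real_of_rat q *\<^sub>R x)"
    using assms by (auto simp: rational_span_def)
  then show ?thesis
    unfolding rational_span_def by (intro image_eqI[of _ _ "L @ M"]) auto
qed

lemma rational_span_scale:
  assumes "x \<in> rational_span C"
  shows "real_of_rat q *\<^sub>R x \<in> rational_span C"
proof -
  obtain L where L: "L \<in> lists (UNIV \<times> C)" "x = (\<Sum>(q, x)\<leftarrow>L. real_of_rat q *\<^sub>R x)"
    using assms by (auto simp: rational_span_def)
  have "real_of_rat q *\<^sub>R (\<Sum>(q, x)\<leftarrow>M. real_of_rat q *\<^sub>R x)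
      = (\<Sum>(q, x)\<leftarrow>map (\<lambda>(r, x). (q * r, x)) M. real_of_rat q *\<^sub>R x)" for M :: "(rat \<times> 'a) list"
    by (induction M) (auto simp: scaleR_add_right of_rat_mult)
  then show ?thesis
    unfolding rational_span_def using L
    by (intro image_eqI[of _ _ "map (\<lambda>(r, x). (q * r, x)) L"]) auto
qed

lemma rational_span_subset_span: "rational_span C \<subseteq> span C"
proof -
  have "(\<Sum>(q, x)\<leftarrow>L. real_of_rat q *\<^sub>R x) \<in> span C" if "L \<in> lists (UNIV \<times> C)" for L
    using that by (induction L) (auto simp: span_zero intro: span_add span_scale span_base)
  then show ?thesis by (auto simp: rational_span_def)
qed

text \<open>Real multiples are only required to land in the closure, since the intended
  \<open>S\<close> is a rational span, which admits rational scalars only.\<close>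

lemma subspace_closureI:
  fixes S :: "'a::real_normed_vector set"
  assumes "0 \<in> S" and add: "\<And>x y. x \<in> S \<Longrightarrow> y \<in> S \<Longrightarrow> x + y \<in> S"
    and scale: "\<And>c x. x \<in> S \<Longrightarrow> c *\<^sub>R x \<in> closure S"
  shows "subspace (closure S)"
  unfolding subspace_def
proof (intro conjI ballI allI)
  show "0 \<in> closure S"
    using \<open>0 \<in> S\<close> closure_subset by blast
  fix x assume x: "x \<in> closure S"
  have "(\<lambda>x. c *\<^sub>R x) ` closure S \<subseteq> closure S" for c
    by (intro image_closure_subset) (auto intro!: continuous_intros scale)
  then show "c *\<^sub>R x \<in> closure S" for c
    using x by blast
  fix y assume y: "y \<in> closure S"
  obtain f where f: "\<forall>n. f n \<in> S" "f \<longlonglongrightarrow> x"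
    using x unfolding closure_sequential by blast
  obtain g where g: "\<forall>n. g n \<in> S" "g \<longlonglongrightarrow> y"
    using y unfolding closure_sequential by blast
  show "x + y \<in> closure S"
    unfolding closure_sequential using f g add
    by (intro exI[of _ "\<lambda>n. f n + g n"]) (auto intro: tendsto_add)
qed

section \<open>Closed spans and separable subspaces\<close>

lemma subspace_closed_span: "subspace (closed_span C)"
  unfolding closed_span_def
  by (rule subspace_closureI)
    (auto intro: span_zero span_add span_scale closure_subset[THEN subsetD])

lemma closed_closed_span: "closed (closed_span C)"
  by (simp add: closed_span_def)

lemma closed_span_superset: "C \<subseteq> closed_span C"
  unfolding closed_span_def using closure_subset span_superset by blast

lemma closed_span_minimal: "C \<subseteq> V \<Longrightarrow> subspace V \<Longrightarrow> closed V \<Longrightarrow> closed_span C \<subseteq> V"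
  unfolding closed_span_def by (simp add: closure_minimal span_minimal)

lemma closed_span_mono: "C \<subseteq> D \<Longrightarrow> closed_span C \<subseteq> closed_span D"
  unfolding closed_span_def by (simp add: closure_mono span_mono)

text \<open>Approximating a real scalar by rationals shows that the closure of the rational span is
  a closed subspace containing \<open>C\<close>.\<close>

lemma closure_rational_span: "closure (rational_span C) = closed_span C"
proof
  show "closure (rational_span C) \<subseteq> closed_span C"
    unfolding closed_span_def by (simp add: closure_mono rational_span_subset_span)
  have "c *\<^sub>R x \<in> closure (rational_span C)" if "x \<in> rational_span C" for c x
    unfolding closure_approachable
  proof (intro allI impI)
    fix e :: real assume e: "e > 0"
    \<comment> \<open>The summand 1 in the denominator covers the case \<open>x = 0\<close>.\<close>
    obtain r where "r \<in> \<rat>" "c < r" "r < c + e / (norm x + 1)"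
      using Rats_dense_in_real[of c "c + e / (norm x + 1)"] e norm_ge_zero[of x]
      by (metis add.commute add_pos_nonneg divide_pos_pos less_add_same_cancel1 zero_less_one)
    then obtain q where q: "c < real_of_rat q" "real_of_rat q < c + e / (norm x + 1)"
      by (auto elim: Rats_cases)
    have "dist (real_of_rat q *\<^sub>R x) (c *\<^sub>R x) = (real_of_rat q - c) * norm x"
      using q by (simp add: dist_norm flip: scaleR_diff_left)
    also have "\<dots> \<le> e / (norm x + 1) * norm x"
      using q by (intro mult_right_mono) auto
    also have "\<dots> < e"
      using e by (auto simp: divide_less_eq algebra_simps not_less intro: add_nonneg_pos add_nonneg_nonneg)
    finally show "\<exists>y\<in>rational_span C. dist y (c *\<^sub>R x) < e"
      using rational_span_scale[OF that] by blast
  qed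
  then have "subspace (closure (rational_span C))"
    by (intro subspace_closureI) (auto intro: rational_span_add rational_span_zero)
  moreover have "C \<subseteq> closure (rational_span C)"
    using rational_span_superset closure_subset by blast
  ultimately show "closed_span C \<subseteq> closure (rational_span C)"
    by (intro closed_span_minimal) auto
qed

lemma closed_span_separable:
  assumes "countable C"
  shows "closed_span C \<in> separable_closed_subspaces"
  unfolding separable_closed_subspaces_def separable_space_def
proof (intro CollectI conjI exI[of _ "rational_span C"])
  have sub: "rational_span C \<subseteq> closed_span C"
    using closure_subset closure_rational_span by blast
  then show "rational_span C \<subseteq> topspace (top_of_set (closed_span C))" by simp
  show "top_of_set (closed_span C) closure_of rational_span C = topspace (top_of_set (closed_span C))"
    using sub by (simp add: closure_of_subtopology Int_absorb1 closure_rational_span)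
qed (use assms in \<open>simp_all add: subspace_closed_span closed_closed_span countable_rational_span\<close>)

lemma separable_closed_subspaceE:
  assumes "V \<in> separable_closed_subspaces"
  obtains D where "countable D" "D \<subseteq> V" "V \<subseteq> closure D"
proof -
  obtain D where "countable D" "D \<subseteq> V" "top_of_set V closure_of D = V"
    using assms by (auto simp: separable_closed_subspaces_def separable_space_def)
  moreover have "top_of_set V closure_of D \<subseteq> closure D"
    using \<open>D \<subseteq> V\<close> by (simp add: closure_of_subtopology Int_absorb1)
  ultimately show thesis using that by blast
qed

section \<open>Increasing unions and closing off under countable operations\<close>

lemma rational_span_incseq_Union:
  fixes C :: "nat \<Rightarrow> 'a::real_vector set"
  assumes inc: "\<And>i. C i \<subseteq> C (Suc i)"
  shows "rational_span (\<Union>i. C i) = (\<Union>i. rational_span (C i))"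
proof
  have mono: "C i \<subseteq> C j" if "i \<le> j" for i j
    using lift_Suc_mono_le[of C, OF inc that] .
  \<comment> \<open>A list has finitely many entries, so a single stage contains all of
    them.\<close>
  have "\<exists>i. L \<in> lists (UNIV \<times> C i)" if "L \<in> lists (UNIV \<times> (\<Union>i. C i))" for L :: "(rat \<times> 'a) list"
    using that
  proof (induction L)
    case (Cons p L)
    then obtain i j where "L \<in> lists (UNIV \<times> C i)" "p \<in> UNIV \<times> C j" by auto
    moreover have "lists (UNIV \<times> C i) \<subseteq> lists (UNIV \<times> C (max i j))" "C j \<subseteq> C (max i j)"
      using mono[of i "max i j"] mono[of j "max i j"] by (auto intro!: lists_mono)
    ultimately show ?case by (intro exI[of _ "max i j"]) auto
  qed auto
  then show "rational_span (\<Union>i. C i) \<subseteq> (\<Union>i. rational_span (C i))"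
    unfolding rational_span_def by blast
  show "(\<Union>i. rational_span (C i)) \<subseteq> rational_span (\<Union>i. C i)"
    by (auto intro: rational_span_mono[THEN subsetD])
qed

text \<open>Iterate \<open>C \<mapsto> C \<union> \<Phi> C\<close> and take the union of all stages.
  Whatever \<open>\<Phi>\<close> produces from the union is already produced at some stage and has
  been added at the next one.\<close>

lemma closing_off:
  fixes \<Phi> :: "'a set \<Rightarrow> 'a set"
  assumes count: "\<And>C. countable C \<Longrightarrow> countable (\<Phi> C)"
    and cont: "\<And>C :: nat \<Rightarrow> 'a set. (\<And>i. countable (C i)) \<Longrightarrow> (\<And>i. C i \<subseteq> C (Suc i)) \<Longrightarrow>
      \<Phi> (\<Union>i. C i) \<subseteq> (\<Union>i. \<Phi> (C i))"
    and C0: "countable C0"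
  obtains C where "countable C" "C0 \<subseteq> C" "\<Phi> C \<subseteq> C"
proof -
  define D where "D i = ((\<lambda>C. C \<union> \<Phi> C) ^^ i) C0" for i
  have D: "D 0 = C0" "D (Suc i) = D i \<union> \<Phi> (D i)" for i
    by (auto simp: D_def)
  have cD: "countable (D i)" for i
    by (induction i) (auto simp: D C0 count)
  show thesis
  proof
    show "countable (\<Union>i. D i)" using cD by auto
    show "C0 \<subseteq> (\<Union>i. D i)" using D(1) by blast
    have "\<Phi> (\<Union>i. D i) \<subseteq> (\<Union>i. \<Phi> (D i))"
      using cD D by (intro cont) auto
    also have "\<dots> \<subseteq> (\<Union>i. D i)"
      using D(2) by blast
    finally show "\<Phi> (\<Union>i. D i) \<subseteq> (\<Union>i. D i)" .
  qed
qed

subsection \<open>Distances between restrictions\<close>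

lemma bdd_above_restriction:
  "bdd_above ((\<lambda>x. \<bar>restrict_functional V y x - restrict_functional V z x\<bar>) ` (V \<inter> cball 0 1))"
proof (rule bdd_aboveI2)
  fix x :: 'a assume x: "x \<in> V \<inter> cball 0 1"
  have "\<bar>blinfun_apply (y - z) x\<bar> \<le> norm (y - z) * norm x"
    using norm_blinfun[of "y - z" x] by simp
  also have "\<dots> \<le> norm (y - z)"
    using x by (simp add: mult_left_le)
  finally show "\<bar>restrict_functional V y x - restrict_functional V z x\<bar> \<le> norm (y - z)"
    using x by (simp add: restrict_functional_def blinfun.diff_left)
qed

text \<open>Homogeneity turns the supremum over the unit ball into a pointwise estimate on
  \<open>V\<close>; all later arguments about the dual norm of \<open>V\<close> use this
  form.\<close>

lemma subspace_dual_dist_le_iff: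
  assumes V: "subspace V" and e: "0 \<le> e"
  shows "subspace_dual_dist V (restrict_functional V y) (restrict_functional V z) \<le> e
    \<longleftrightarrow> (\<forall>h\<in>V. \<bar>blinfun_apply y h - blinfun_apply z h\<bar> \<le> e * norm h)" (is "?D \<le> e \<longleftrightarrow> ?R")
proof
  assume D: "?D \<le> e"
  show ?R
  proof
    fix h assume h: "h \<in> V"
    show "\<bar>blinfun_apply y h - blinfun_apply z h\<bar> \<le> e * norm h"
    proof (cases "h = 0")
      case False
      define k where "k = (1 / norm h) *\<^sub>R h"
      have k: "k \<in> V \<inter> cball 0 1"
        using h V False by (simp add: k_def subspace_scale)
      have "\<bar>restrict_functional V y k - restrict_functional V z k\<bar> \<le> ?D"
        unfolding subspace_dual_dist_def by (rule cSUP_upper[OF k bdd_above_restriction])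
      then have "\<bar>blinfun_apply y k - blinfun_apply z k\<bar> \<le> e"
        using D k by (simp add: restrict_functional_def)
      then have "\<bar>blinfun_apply y h - blinfun_apply z h\<bar> / norm h \<le> e"
        using False by (simp add: k_def blinfun.scaleR_right flip: diff_divide_distrib)
      then show ?thesis using False by (simp add: field_simps)
    qed (simp add: blinfun.zero_right)
  qed
next
  assume R: ?R
  show "?D \<le> e"
    unfolding subspace_dual_dist_def
  proof (rule cSUP_least)
    show "V \<inter> cball 0 1 \<noteq> {}" using V by (auto dest: subspace_0)
    fix x assume x: "x \<in> V \<inter> cball 0 1"
    then have "\<bar>blinfun_apply y x - blinfun_apply z x\<bar> \<le> e * norm x" using R by auto
    also have "\<dots> \<le> e" using x e by (simp add: mult_left_le)
    finally show "\<bar>restrict_functional V y x - restrict_functional V z x\<bar> \<le> e"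
      using x by (simp add: restrict_functional_def)
  qed
qed

lemma subspace_dual_dist_nonneg:
  assumes "subspace V"
  shows "0 \<le> subspace_dual_dist V (restrict_functional V y) (restrict_functional V z)"
  using cSUP_upper[OF _ bdd_above_restriction, of 0 V y z] subspace_0[OF assms] 
  unfolding subspace_dual_dist_def by fastforce

text \<open>Restriction never increases distances, so only the reverse estimate has to be
  supplied.\<close>

lemma restriction_isometricI:
  assumes V: "subspace V"
    and le: "\<And>y1 y2 e. y1 \<in> Y \<Longrightarrow> y2 \<in> Y \<Longrightarrow> 0 \<le> e \<Longrightarrow>
      (\<And>h. h \<in> V \<Longrightarrow> \<bar>blinfun_apply y1 h - blinfun_apply y2 h\<bar> \<le> e * norm h) \<Longrightarrow> dist y1 y2 \<le> e"
  shows "restriction_isometric V Y"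
  unfolding restriction_isometric_def
proof (intro ballI antisym)
  fix y1 y2 assume y: "y1 \<in> Y" "y2 \<in> Y"
  have "\<bar>blinfun_apply y1 h - blinfun_apply y2 h\<bar> \<le> dist y1 y2 * norm h" for h
    using norm_blinfun[of "y1 - y2" h] by (simp add: blinfun.diff_left dist_norm)
  then show "subspace_dual_dist V (restrict_functional V y1) (restrict_functional V y2) \<le> dist y1 y2"
    using V by (simp add: subspace_dual_dist_le_iff)
  show "dist y1 y2 \<le> subspace_dual_dist V (restrict_functional V y1) (restrict_functional V y2)"
    using le[OF y subspace_dual_dist_nonneg[OF V]] V
      subspace_dual_dist_le_iff[OF V subspace_dual_dist_nonneg[OF V]] by blast
qed

lemma restriction_isometricD:
  assumes "restriction_isometric V Y" "subspace V" "y1 \<in> Y" "y2 \<in> Y" "0 \<le> e"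
    and "\<And>h. h \<in> V \<Longrightarrow> \<bar>blinfun_apply y1 h - blinfun_apply y2 h\<bar> \<le> e * norm h"
  shows "dist y1 y2 \<le> e"
  using assms subspace_dual_dist_le_iff[of V e y1 y2] unfolding restriction_isometric_def by metis

subsection \<open>Separable duals imply differentiability\<close>

text \<open>Add the subgradient inequality at \<open>u\<close>, tested at \<open>v\<close>, to the
  one at \<open>v\<close>, tested at \<open>u\<close>.\<close>

lemma subgradient_monotone:
  fixes f :: "'a::real_normed_vector \<Rightarrow> real"
  assumes "\<And>x z. f x + blinfun_apply (s x) (z - x) \<le> f z"
  shows "0 \<le> blinfun_apply (s u - s v) (u - v)"
proof -
  have "f u + blinfun_apply (s u) (v - u) \<le> f v" "f v + blinfun_apply (s v) (u - v) \<le> f u"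
    by (rule assms)+
  moreover have "blinfun_apply (s u) (v - u) = - blinfun_apply (s u) (u - v)"
    by (metis blinfun.minus_right minus_diff_eq)
  ultimately show ?thesis by (simp add: blinfun.diff_left)
qed

text \<open>On the ball of radius \<open>d\<close> around \<open>x\<close>, two values of
  \<open>f\<close> differ by less than 2. A step of length \<open>d / 4\<close> from a point within
  \<open>d / 2\<close> of \<open>x\<close> stays in that ball, so no subgradient there has slope
  above \<open>8 / d\<close>.\<close>

lemma subgradient_locally_bounded:
  fixes f :: "'a::real_normed_vector \<Rightarrow> real"
  assumes sub: "\<And>x z. f x + blinfun_apply (s x) (z - x) \<le> f z"
    and cont: "continuous_on UNIV f"
  obtains r L where "r > 0" "\<And>u. dist u x < r \<Longrightarrow> norm (s u) \<le> L"
proof -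
  obtain d where d: "d > 0" "\<And>z. dist z x < d \<Longrightarrow> dist (f z) (f x) < 1"
    using cont unfolding continuous_on_iff by (metis UNIV_I zero_less_one)
  have bound: "blinfun_apply (s u) h \<le> 8 / d * norm h" if u: "dist u x < d / 2" for u h
  proof (cases "h = 0")
    case False
    define c where "c = d / (4 * norm h)"
    have c: "c > 0" using False d by (simp add: c_def)
    have "norm (c *\<^sub>R h) = d / 4" using False d by (simp add: c_def)
    then have "dist (u + c *\<^sub>R h) x < d"
      using u d(1) norm_triangle_ineq[of "u - x" "c *\<^sub>R h"] by (simp add: dist_norm algebra_simps)
    then have "f (u + c *\<^sub>R h) - f u < 2"
      using d(2)[of "u + c *\<^sub>R h"] d(2)[of u] u d(1) by (simp add: dist_real_def)
    moreover have "f u + blinfun_apply (s u) (c *\<^sub>R h) \<le> f (u + c *\<^sub>R h)"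
      using sub[of u "u + c *\<^sub>R h"] by simp
    ultimately have "c * blinfun_apply (s u) h \<le> 2"
      by (simp add: blinfun.scaleR_right)
    then show ?thesis
      using c False d by (simp add: c_def field_simps)
  qed (simp add: blinfun.zero_right)
  show thesis
  proof (rule that[of "d / 2" "8 / d"])
    show "norm (s u) \<le> 8 / d" if "dist u x < d / 2" for u
    proof (rule norm_blinfun_bound)
      show "norm (blinfun_apply (s u) h) \<le> 8 / d * norm h" for h
        using bound[OF that, of h] bound[OF that, of "- h"] by (simp add: blinfun.minus_right abs_le_iff)
    qed (use d in simp)
  qed (use d in simp)
qed

text \<open>The subgradient inequalities at \<open>x\<close> and at \<open>y\<close> place
  \<open>f y - f x\<close> between \<open>s x (y - x)\<close> and \<open>s y (y - x)\<close>. Norm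
  continuity of \<open>s\<close> at \<open>x\<close> makes the gap at most
  \<open>e * norm (y - x)\<close>.\<close>

lemma differentiable_of_continuous_subgradient:
  fixes f :: "'a::real_normed_vector \<Rightarrow> real"
  assumes sub: "\<And>x z. f x + blinfun_apply (s x) (z - x) \<le> f z"
    and cont: "\<And>e. e > 0 \<Longrightarrow> \<exists>r>0. \<forall>u\<in>ball x r. dist (s u) (s x) \<le> e"
  shows "f differentiable (at x)"
proof -
  have "(f has_derivative blinfun_apply (s x)) (at x)"
    unfolding has_derivative_at_alt
  proof (intro conjI allI impI)
    show "bounded_linear (blinfun_apply (s x))" by (rule blinfun.bounded_linear_right)
    fix e :: real assume "e > 0"
    then obtain r where r: "r > 0" "\<And>u. u \<in> ball x r \<Longrightarrow> dist (s u) (s x) \<le> e"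
      using cont by blast
    have "norm (f y - f x - blinfun_apply (s x) (y - x)) \<le> e * norm (y - x)"
      if y: "norm (y - x) < r" for y
    proof -
      have lower: "f x + blinfun_apply (s x) (y - x) \<le> f y" by (rule sub)
      have "f y - f x \<le> blinfun_apply (s y) (y - x)"
        using sub[of y x] blinfun.minus_right[of "s y" "y - x"] by simp
      then have "f y - f x - blinfun_apply (s x) (y - x) \<le> blinfun_apply (s y - s x) (y - x)"
        by (simp add: blinfun.diff_left)
      also have "\<dots> \<le> norm (s y - s x) * norm (y - x)"
        using norm_blinfun[of "s y - s x" "y - x"] by simp
      also have "\<dots> \<le> e * norm (y - x)"
        using r(2)[of y] y by (intro mult_right_mono) (auto simp: dist_norm norm_minus_commute)
      finally show ?thesis using lower by simp
    qed
    then show "\<exists>d>0. \<forall>y. norm (y - x) < d \<longrightarrow>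
        norm (f y - f x - blinfun_apply (s x) (y - x)) \<le> e * norm (y - x)"
      using r(1) by blast
  qed
  then show ?thesis by (auto simp: differentiable_def)
qed

text \<open>The set \<open>D n\<close> of points near which \<open>s\<close> oscillates by at most
  \<open>1 / (n + 1)\<close> is open. If every \<open>D n\<close> were dense, Baire would give a
  point in all of them; there \<open>s\<close> is norm continuous and \<open>f\<close>
  differentiable. So some \<open>D n\<close> misses a ball.\<close>

lemma large_oscillation_on_ball:
  fixes f :: "'a::banach \<Rightarrow> real"
  assumes sub: "\<And>x z. f x + blinfun_apply (s x) (z - x) \<le> f z"
    and nondiff: "\<And>x. \<not> f differentiable (at x)"
  obtains x0 r0 e where "r0 > 0" "e > 0"
    "\<And>x r. x \<in> ball x0 r0 \<Longrightarrow> r > 0 \<Longrightarrow> \<exists>u\<in>ball x r. \<exists>v\<in>ball x r. e < dist (s u) (s v)"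
proof -
  define D where "D n = {x. \<exists>r>0. \<forall>u\<in>ball x r. \<forall>v\<in>ball x r. dist (s u) (s v) \<le> 1 / real (Suc n)}" for n
  have openD: "open (D n)" for n
    unfolding open_dist
  proof
    fix x assume "x \<in> D n"
    then obtain r where r: "r > 0" "\<And>u v. u \<in> ball x r \<Longrightarrow> v \<in> ball x r \<Longrightarrow> dist (s u) (s v) \<le> 1 / real (Suc n)"
      by (auto simp: D_def)
    have "y \<in> D n" if "dist y x < r / 2" for y
    proof -
      have "ball y (r / 2) \<subseteq> ball x r"
      proof
        fix w assume "w \<in> ball y (r / 2)"
        then show "w \<in> ball x r"
          using that dist_triangle[of x w y] by (simp add: dist_commute)
      qed
      then have "\<forall>u\<in>ball y (r / 2). \<forall>v\<in>ball y (r / 2). dist (s u) (s v) \<le> 1 / real (Suc n)"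
        using r(2) by blast
      then show ?thesis
        unfolding D_def using r(1) by (intro CollectI exI[of _ "r / 2"]) auto
    qed
    then show "\<exists>e>0. \<forall>y. dist y x < e \<longrightarrow> y \<in> D n"
      using r(1) by (intro exI[of _ "r / 2"]) auto
  qed
  have "\<exists>n. closure (D n) \<noteq> UNIV"
  proof (rule ccontr)
    assume "\<not> ?thesis"
    then have "closure (\<Inter>(range D)) = UNIV"
      using Baire_category[of "euclidean :: 'a topology" "range D"] openD
      by (auto simp: completely_metrizable_space_euclidean)
    then have "\<Inter>(range D) \<noteq> {}" by (metis closure_empty UNIV_not_empty)
    then obtain x where x: "\<And>n. x \<in> D n" by blast
    have "f differentiable (at x)"
    proof (rule differentiable_of_continuous_subgradient[OF sub])
      fix e :: real assume "e > 0"
      then obtain n where n: "1 / real (Suc n) < e"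
        using nat_approx_posE by blast
      obtain r where "r > 0" "\<And>u v. u \<in> ball x r \<Longrightarrow> v \<in> ball x r \<Longrightarrow> dist (s u) (s v) \<le> 1 / real (Suc n)"
        using x[of n] by (auto simp: D_def)
      then show "\<exists>r>0. \<forall>u\<in>ball x r. dist (s u) (s x) \<le> e"
        using n by (meson centre_in_ball less_imp_le order_trans)
    qed
    then show False using nondiff by blast
  qed
  then obtain n x0 where "x0 \<notin> closure (D n)" by blast
  then obtain r0 where r0: "r0 > 0" "ball x0 r0 \<inter> D n = {}"
  proof -
    obtain r0 where "r0 > 0" "ball x0 r0 \<subseteq> - closure (D n)"
      using \<open>x0 \<notin> closure (D n)\<close> open_contains_ball[of "- closure (D n)"] by auto
    then show thesis using that closure_subset[of "D n"] by blast
  qed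
  show thesis
  proof (rule that[of r0 "1 / real (Suc n)" x0])
    show "\<exists>u\<in>ball x r. \<exists>v\<in>ball x r. 1 / real (Suc n) < dist (s u) (s v)"
      if "x \<in> ball x0 r0" "r > 0" for x r
    proof -
      have "x \<notin> D n" using that r0 by blast
      then show ?thesis using \<open>r > 0\<close> by (auto simp: D_def not_le)
    qed
  qed (use r0 in auto)
qed

text \<open>The hypothesis is separability of the dual of \<open>closed_span C\<close>, phrased with
  functionals on the whole space, which Hahn--Banach permits. It contradicts a subgradient selection
  that oscillates by more than \<open>e\<close> everywhere on a ball, once that oscillation is
  visible inside one separable subspace.\<close>

lemma asplund_if_separable_duals:
  assumes sep: "\<And>C :: 'a::banach set. countable C \<Longrightarrow>
    \<exists>D :: ('a \<Rightarrow>\<^sub>L real) set. countable D \<and> (\<forall>y. \<forall>e>0. \<exists>d\<in>D.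
      \<forall>h\<in>closed_span C. \<bar>blinfun_apply y h - blinfun_apply d h\<bar> \<le> e * norm h)"
  shows "asplund_space TYPE('a)"
  unfolding asplund_space_def
proof (intro allI impI, rule ccontr)
  fix f :: "'a \<Rightarrow> real"
  assume f: "convex_on UNIV f \<and> continuous_on UNIV f" and nd: "\<not> (\<exists>x. f differentiable at x)"
  have "\<exists>y. \<forall>z. f x + blinfun_apply y (z - x) \<le> f z" for x
    using subgradient_exists f by metis
  then obtain s where s: "\<And>x z. f x + blinfun_apply (s x) (z - x) \<le> f z"
    by metis
  obtain x0 r0 e where r0: "r0 > 0" and e: "e > 0" and
    osc: "\<And>x r. x \<in> ball x0 r0 \<Longrightarrow> r > 0 \<Longrightarrow> \<exists>u\<in>ball x r. \<exists>v\<in>ball x r. e < dist (s u) (s v)"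
  proof (rule large_oscillation_on_ball[of f s, OF s])
    show "\<not> f differentiable at x" for x using nd by blast
  qed blast
  \<comment> \<open>The vector \<open>h\<close> witnesses that the difference of the two
    subgradients has norm above \<open>e\<close>, so the oscillation persists after restriction to
    any subspace containing \<open>u\<close>, \<open>v\<close> and \<open>h\<close>.\<close>
  have "\<exists>u v h. u \<in> ball x (1 / Suc k) \<and> v \<in> ball x (1 / Suc k) \<and>
      e * norm h < \<bar>blinfun_apply (s u) h - blinfun_apply (s v) h\<bar>" if x: "x \<in> ball x0 r0" for x and k :: nat
  proof -
    obtain u v where uv: "u \<in> ball x (1 / Suc k)" "v \<in> ball x (1 / Suc k)" "e < norm (s u - s v)"
      using osc[OF x, of "1 / Suc k"] unfolding dist_norm by auto
    then obtain h where "e * norm h < norm (blinfun_apply (s u - s v) h)"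
      using norm_blinfun_bound[of e "s u - s v"] e by (meson leD leI less_imp_le)
    then show ?thesis using uv by (auto simp: blinfun.diff_left)
  qed
  then obtain u v h where uvh: "\<And>x k. x \<in> ball x0 r0 \<Longrightarrow> u x k \<in> ball x (1 / Suc k) \<and>
      v x k \<in> ball x (1 / Suc k) \<and>
      e * norm (h x k) < \<bar>blinfun_apply (s (u x k)) (h x k) - blinfun_apply (s (v x k)) (h x k)\<bar>"
    by metis
  define T where "T x = range (u x) \<union> range (v x) \<union> range (h x)" for x
  \<comment> \<open>Closing off puts the oscillation witnesses of every point of
    \<open>rational_span C\<close> into \<open>C\<close>; these points are dense in the closed
    span.\<close>
  obtain C where C: "countable C" "{x0} \<subseteq> C" "(\<Union>c\<in>rational_span C. T c) \<subseteq> C"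
  proof (rule closing_off[of "\<lambda>C. \<Union>c\<in>rational_span C. T c" "{x0}"])
    show "countable (\<Union>c\<in>rational_span C. T c)" if "countable C" for C
      using that by (auto simp: T_def intro: countable_rational_span)
  qed (auto simp: rational_span_incseq_Union)
  define V where "V = closed_span C"
  have V: "subspace V" "closed V" "V = closure (rational_span C)" "C \<subseteq> V"
    by (auto simp: V_def subspace_closed_span closed_closed_span closure_rational_span
        closed_span_superset[THEN subsetD])
  obtain D :: "('a \<Rightarrow>\<^sub>L real) set" where D: "countable D"
    "\<And>y e. e > 0 \<Longrightarrow> \<exists>d\<in>D. \<forall>h\<in>V. \<bar>blinfun_apply y h - blinfun_apply d h\<bar> \<le> e * norm h"
    using sep[OF C(1)] V_def by blast
  \<comment> \<open>The points whose subgradient is within \<open>e / 4\<close> of \<open>d\<close>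
    on \<open>V\<close>. Two such points have subgradients within \<open>e / 2\<close> of each other
    on \<open>V\<close>, which is incompatible with oscillation above \<open>e\<close>.\<close>
  define A where "A d = {w \<in> V \<inter> ball x0 r0. \<forall>h\<in>V. \<bar>blinfun_apply (s w) h - blinfun_apply d h\<bar> \<le> e / 4 * norm h}" for d
  have AV: "A d \<subseteq> V" for d by (auto simp: A_def)
  have cover: "V \<inter> ball x0 r0 \<subseteq> (\<Union>d\<in>D. closure (A d))"
  proof
    fix w assume w: "w \<in> V \<inter> ball x0 r0"
    obtain d where d: "d \<in> D" "\<forall>h\<in>V. \<bar>blinfun_apply (s w) h - blinfun_apply d h\<bar> \<le> e / 4 * norm h"
      using D(2)[of "e / 4" "s w"] e by auto
    then have "w \<in> A d" using w unfolding A_def by blast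
    then show "w \<in> (\<Union>d\<in>D. closure (A d))"
      using d(1) closure_subset by blast
  qed
  \<comment> \<open>Baire in the complete space \<open>V\<close>: countably many closed sets cover a
    nonempty relatively open set, so one of them has interior.\<close>
  have "\<exists>d\<in>D. (top_of_set V) interior_of (closure (A d)) \<noteq> {}"
  proof (rule ccontr)
    assume "\<not> ?thesis"
    moreover have "completely_metrizable_space (top_of_set V)"
      using V by (simp add: completely_metrizable_space_closedin completely_metrizable_space_euclidean)
    moreover have "closure (A d) \<subseteq> V" for d
      using AV V by (simp add: closure_minimal)
    ultimately have "(top_of_set V) interior_of (\<Union>d\<in>D. closure (A d)) = {}"
      using D(1) by (intro Baire_category_alt) (auto simp: closedin_closed_eq V(2))
    moreover have "V \<inter> ball x0 r0 \<subseteq> (top_of_set V) interior_of (\<Union>d\<in>D. closure (A d))"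
      by (rule interior_of_maximal[OF cover]) (simp add: openin_open_Int)
    moreover have "x0 \<in> V \<inter> ball x0 r0"
      using C V r0 by auto
    ultimately show False by blast
  qed
  then obtain d z0 where z0: "z0 \<in> (top_of_set V) interior_of (closure (A d))" by blast
  obtain W where W: "open W" "z0 \<in> V \<inter> W" "V \<inter> W \<subseteq> closure (A d)"
  proof -
    have "openin (top_of_set V) ((top_of_set V) interior_of (closure (A d)))" by simp
    then obtain W where "open W" "(top_of_set V) interior_of (closure (A d)) = V \<inter> W"
      unfolding openin_open by blast
    then show thesis using that z0 interior_of_subset[of "top_of_set V" "closure (A d)"] by blast
  qed
  then obtain z where z: "z \<in> A d" "z \<in> W"
    using closure_iff_nhds_not_empty[of z0 "A d"] by (metis IntE disjoint_iff subsetD order_refl)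
  then have "z \<in> W \<inter> ball x0 r0" by (simp add: A_def)
  then obtain r where r: "r > 0" "ball z r \<subseteq> W \<inter> ball x0 r0"
    using W(1) by (meson open_Int open_ball open_contains_ball)
  have dense: "V \<inter> ball z r \<subseteq> closure (A d)"
    using r W by blast
  \<comment> \<open>Monotonicity carries the estimate from the dense set \<open>A d\<close> to all points: compare \<open>s w\<close>
    with \<open>s a\<close> for \<open>a \<in> A d\<close> close to \<open>w + t k\<close>.\<close>
  have near: "blinfun_apply (s w) k - blinfun_apply d k \<le> e / 4 * norm k"
    if w: "w \<in> V" "w \<in> ball z r" and k: "k \<in> V" for w k
  proof (rule field_le_epsilon)
    fix \<eta> :: real assume \<eta>: "\<eta> > 0"
    obtain \<rho> L where \<rho>: "\<rho> > 0" and L: "\<And>a. dist a w < \<rho> \<Longrightarrow> norm (s a) \<le> L"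
      using subgradient_locally_bounded[OF s] f by metis
    have L0: "L \<ge> 0" using L[of w] \<rho> norm_ge_zero[of "s w"] by (metis dist_self order_trans)
    obtain \<sigma> where \<sigma>: "\<sigma> > 0" "ball w \<sigma> \<subseteq> ball z r"
      using w by (meson open_ball open_contains_ball)
    define m where "m = min \<rho> \<sigma>"
    have m: "m > 0" using \<rho> \<sigma> by (simp add: m_def)
    \<comment> \<open>This keeps \<open>t k\<close> shorter than \<open>m / 2\<close>, also for
      \<open>k = 0\<close>.\<close>
    define t where "t = m / (2 * (norm k + 1))"
    have nk: "norm k + 1 > 0" by (simp add: add_nonneg_pos)
    have t: "t > 0" using m nk by (simp add: t_def)
    have "t * norm k \<le> t * (norm k + 1)" using t by simp
    then have tk: "norm (t *\<^sub>R k) \<le> m / 2" using t nk by (simp add: t_def field_simps)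
    have "w + t *\<^sub>R k \<in> V" using w k V by (simp add: subspace_add subspace_scale)
    moreover have "w + t *\<^sub>R k \<in> ball w \<sigma>"
      using tk m by (simp add: dist_norm m_def)
    ultimately have "w + t *\<^sub>R k \<in> closure (A d)" using \<sigma> dense by blast
    \<comment> \<open>The first bound keeps \<open>a\<close> within \<open>m\<close> of
      \<open>w\<close>. The second makes the error term, at most \<open>2 * L * \<delta>\<close>, no
      larger than \<open>t * \<eta>\<close>, which becomes \<open>\<eta>\<close> after division by
      \<open>t\<close>; the summand 1 covers \<open>L = 0\<close>.\<close>
    moreover define \<delta> where "\<delta> = min (m / 2) (t * \<eta> / (2 * L + 1))"
    have \<delta>: "\<delta> > 0" using m t \<eta> L0 by (simp add: \<delta>_def)
    ultimately obtain a where a: "a \<in> A d" "dist a (w + t *\<^sub>R k) < \<delta>"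
      unfolding closure_approachable by blast
    define p where "p = a - w - t *\<^sub>R k"
    have p: "norm p < \<delta>" using a by (simp add: p_def dist_norm algebra_simps)
    have aw: "a - w = t *\<^sub>R k + p" by (simp add: p_def)
    have "dist a w \<le> norm (t *\<^sub>R k) + norm p"
      unfolding dist_norm aw by (rule norm_triangle_ineq)
    also have "\<dots> < m" using tk p by (simp add: \<delta>_def)
    finally have "norm (s a) \<le> L" using L by (simp add: m_def)
    moreover have "norm (s w) \<le> L" using L \<rho> by simp
    ultimately have "norm (s a - s w) \<le> 2 * L"
      using norm_triangle_ineq4[of "s a" "s w"] by linarith
    then have "norm (s a - s w) * norm p \<le> 2 * L * \<delta>"
      using p L0 by (intro mult_mono) auto
    then have "blinfun_apply (s a - s w) p \<le> 2 * L * \<delta>"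
      using norm_blinfun[of "s a - s w" p] by simp
    also have "\<dots> \<le> (2 * L + 1) * \<delta>" using \<delta> by (simp add: algebra_simps)
    also have "\<dots> \<le> (2 * L + 1) * (t * \<eta> / (2 * L + 1))"
      using L0 by (intro mult_left_mono) (auto simp: \<delta>_def)
    also have "\<dots> = t * \<eta>" using L0 by simp
    finally have "blinfun_apply (s a - s w) p \<le> t * \<eta>" .
    moreover have "0 \<le> blinfun_apply (s a - s w) (t *\<^sub>R k + p)"
      using subgradient_monotone[of f s a w, OF s] by (simp add: aw)
    ultimately have "t * blinfun_apply (s w) k \<le> t * blinfun_apply (s a) k + t * \<eta>"
      by (simp add: blinfun.add_right blinfun.diff_left blinfun.scaleR_right algebra_simps)
    then have "blinfun_apply (s w) k \<le> blinfun_apply (s a) k + \<eta>"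
      using t by (simp flip: distrib_left)
    moreover have "\<bar>blinfun_apply (s a) k - blinfun_apply d k\<bar> \<le> e / 4 * norm k"
      using a k by (auto simp: A_def)
    ultimately show "blinfun_apply (s w) k - blinfun_apply d k \<le> e / 4 * norm k + \<eta>" by linarith
  qed
  have near': "\<bar>blinfun_apply (s w) k - blinfun_apply d k\<bar> \<le> e / 4 * norm k"
    if "w \<in> V" "w \<in> ball z r" "k \<in> V" for w k
  proof -
    have "- k \<in> V" using that V by (simp add: subspace_neg)
    then show ?thesis
      using near[OF that] near[OF that(1,2), of "- k"]
      unfolding abs_le_iff by (simp add: blinfun.minus_right)
  qed
  \<comment> \<open>A point \<open>c\<close> of the rational span near \<open>z\<close> has its
    witnesses in \<open>V\<close> and in \<open>ball z r\<close>, where both subgradients are within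
    \<open>e / 4\<close> of \<open>d\<close>: the contradiction.\<close>
  have "z \<in> closure (rational_span C)" using z V by (auto simp: A_def)
  then obtain c where c: "c \<in> rational_span C" "dist c z < r / 2"
    using r unfolding closure_approachable by (metis half_gt_zero)
  obtain k :: nat where k: "1 / Suc k < r / 2"
    using nat_approx_posE[of "r / 2"] r by auto
  have sub: "ball c (1 / Suc k) \<subseteq> ball z r"
  proof
    fix w assume "w \<in> ball c (1 / Suc k)"
    then show "w \<in> ball z r"
      using c(2) k dist_triangle[of z w c] by (simp add: dist_commute)
  qed
  have "c \<in> ball z r" using c(2) r(1) by (simp add: dist_commute)
  then have "c \<in> ball x0 r0" using r(2) by blast
  from uvh[OF this, of k]
  have g: "u c k \<in> ball z r" "v c k \<in> ball z r"
    "e * norm (h c k) < \<bar>blinfun_apply (s (u c k)) (h c k) - blinfun_apply (s (v c k)) (h c k)\<bar>"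
    using sub by blast+
  have "u c k \<in> V" "v c k \<in> V" "h c k \<in> V"
    using C(3) c(1) V(4) unfolding T_def by blast+
  then have "\<bar>blinfun_apply (s (u c k)) (h c k) - blinfun_apply (s (v c k)) (h c k)\<bar> \<le> e / 2 * norm (h c k)"
    using near'[of "u c k" "h c k"] near'[of "v c k" "h c k"] g by linarith
  moreover have "e / 2 * norm (h c k) \<le> e * norm (h c k)"
    using e by (intro mult_right_mono) auto
  ultimately show False using g(3) by linarith
qed

text \<open>Cofinality encloses a given closed span in some \<open>V\<close>. By surjectivity every
  functional agrees on \<open>V\<close> with a member of \<open>Y\<close>, so a countable dense
  subset of \<open>Y\<close> approximates all functionals on the smaller subspace.\<close>

lemma asplund_if_cofinal_surjective:
  fixes A :: "('a::banach \<times> ('a \<Rightarrow>\<^sub>L real)) set set"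
  assumes A: "rectangle_family A" "cofinal_family A"
    and surj: "\<And>V Y. V \<times> Y \<in> A \<Longrightarrow> restriction_surjective V Y"
  shows "asplund_space TYPE('a)"
proof (rule asplund_if_separable_duals)
  fix C :: "'a set" assume C: "countable C"
  \<comment> \<open>The zero space as second factor; it contains 0, so inclusion of rectangles
    implies inclusion of the first factors.\<close>
  let ?Y0 = "closed_span {} :: ('a \<Rightarrow>\<^sub>L real) set"
  have "closed_span C \<times> ?Y0 \<in> separable_rectangles"
    using closed_span_separable[OF C] closed_span_separable[of "{}"] by (auto simp: separable_rectangles_def)
  then obtain W where W: "W \<in> A" "closed_span C \<times> ?Y0 \<subseteq> W"
    using A(2) unfolding cofinal_family_def by blast
  then have "W \<in> separable_rectangles"
    using A(1) unfolding rectangle_family_def by blast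
  then obtain V Y where WVY: "W = V \<times> Y"
    "V \<in> separable_closed_subspaces" "Y \<in> separable_closed_subspaces"
    unfolding separable_rectangles_def by blast
  with W have VY: "V \<times> Y \<in> A" "closed_span C \<times> ?Y0 \<subseteq> V \<times> Y"
    "V \<in> separable_closed_subspaces" "Y \<in> separable_closed_subspaces"
    by auto
  moreover have "0 \<in> ?Y0"
    using subspace_closed_span by (rule subspace_0)
  ultimately have CV: "closed_span C \<subseteq> V" by blast
  obtain D where D: "countable D" "D \<subseteq> Y" "Y \<subseteq> closure D"
    using separable_closed_subspaceE[OF VY(4)] by metis
  have "\<exists>d\<in>D. \<forall>h\<in>closed_span C. \<bar>blinfun_apply y h - blinfun_apply d h\<bar> \<le> e * norm h"
    if e: "e > 0" for y e
  proof -
    have "restrict_functional V y \<in> restrict_functional V ` Y"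
      using surj[OF VY(1)] VY(3) restrict_functional_in_subspace_dual
      unfolding restriction_surjective_def separable_closed_subspaces_def by blast
    then obtain y' where y': "y' \<in> Y" "restrict_functional V y = restrict_functional V y'" by blast
    then obtain d where d: "d \<in> D" "dist d y' < e"
      using D e closure_approachable by blast
    have "\<bar>blinfun_apply y h - blinfun_apply d h\<bar> \<le> e * norm h" if "h \<in> closed_span C" for h
    proof -
      have "blinfun_apply y h = blinfun_apply y' h"
        using y' CV that by (auto simp: restrict_functional_def restrict_def fun_eq_iff split: if_splits)
      then have "\<bar>blinfun_apply y h - blinfun_apply d h\<bar> \<le> dist y' d * norm h"
        using norm_blinfun[of "y' - d" h] by (simp add: blinfun.diff_left dist_norm)
      also have "\<dots> \<le> e * norm h"
        using d by (intro mult_right_mono) (auto simp: dist_commute)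
      finally show ?thesis .
    qed
    then show ?thesis using d by blast
  qed
  then show "\<exists>D :: ('a \<Rightarrow>\<^sub>L real) set. countable D \<and> (\<forall>y. \<forall>e>0. \<exists>d\<in>D.
      \<forall>h\<in>closed_span C. \<bar>blinfun_apply y h - blinfun_apply d h\<bar> \<le> e * norm h)"
    using D(1) by blast
qed

subsection \<open>The weak* topology\<close>

text \<open>The open sets of the function type \<open>'a \<Rightarrow> real\<close> are those of the
  product topology, so the pullback is pointwise convergence on the space.\<close>

definition weak_star :: "('a::real_normed_vector \<Rightarrow>\<^sub>L real) topology" where
  "weak_star = pullback_topology UNIV blinfun_apply euclidean"

lemma openin_weak_star: "openin weak_star U \<longleftrightarrow> (\<exists>T. open T \<and> U = blinfun_apply -` T)"
  by (simp add: weak_star_def openin_pullback_topology)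

lemma topspace_weak_star [simp]: "topspace weak_star = UNIV"
  by (simp add: weak_star_def topspace_pullback_topology)

lemma openin_weak_star_halfspace: "openin weak_star {y. c < blinfun_apply y x}"
  unfolding openin_weak_star
  by (intro exI[of _ "{g. c < g x}"] conjI open_Collect_less continuous_intros
      continuous_on_product_coordinates) auto

lemma closedin_weak_star_halfspace: "closedin weak_star {y. blinfun_apply y x \<le> c}"
proof -
  have "{y. blinfun_apply y x \<le> c} = UNIV - {y. c < blinfun_apply y x}" by auto
  then show ?thesis
    using openin_weak_star_halfspace[of c x] by (simp add: closedin_def double_diff)
qed

text \<open>Banach--Alaoglu: as functions, the members of the ball form the closed set cut out by
  additivity and homogeneity from a product of intervals \<open>[- m norm x, m norm x]\<close>,
  which is compact by Tychonoff.\<close>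

lemma compactin_weak_star_cball:
  assumes m: "0 \<le> m"
  shows "compactin weak_star (cball 0 m :: ('a::real_normed_vector \<Rightarrow>\<^sub>L real) set)"
proof -
  define K where "K = (\<Pi>\<^sub>E x\<in>UNIV. {- (m * norm x)..m * norm x}) \<inter>
    ({g. \<forall>x y. g (x + y) = g x + g y} \<inter> {g :: 'a \<Rightarrow> real. \<forall>c x. g (c *\<^sub>R x) = c * g x})"
  have "compact (\<Pi>\<^sub>E x\<in>(UNIV :: 'a set). {- (m * norm x)..m * norm x})"
    using compactin_PiE[of "\<lambda>_. euclidean" "UNIV :: 'a set" "\<lambda>x. {- (m * norm x)..m * norm x}"]
    by (simp add: euclidean_product_topology)
  moreover have "closed {g :: 'a \<Rightarrow> real. \<forall>x y. g (x + y) = g x + g y}"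
    by (intro closed_Collect_all closed_Collect_eq continuous_intros continuous_on_product_coordinates)
  moreover have "closed {g :: 'a \<Rightarrow> real. \<forall>c x. g (c *\<^sub>R x) = c * g x}"
    by (intro closed_Collect_all closed_Collect_eq continuous_intros continuous_on_product_coordinates)
  ultimately have K: "compact K"
    unfolding K_def by (intro compact_Int_closed closed_Int)
  have sub: "K \<subseteq> blinfun_apply ` cball 0 m"
  proof
    fix g assume g: "g \<in> K"
    have bound: "\<bar>g x\<bar> \<le> m * norm x" for x
    proof -
      have "g x \<in> {- (m * norm x)..m * norm x}" using g by (auto simp: K_def PiE_iff)
      then show ?thesis by (simp add: abs_le_iff)
    qed
    have bl: "bounded_linear g"
      using g bound by (intro bounded_linear_intro[of g m]) (auto simp: K_def mult.commute)
    have "norm (Blinfun g) \<le> m"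
      using bound m bl by (intro norm_blinfun_bound) (auto simp: bounded_linear_Blinfun_apply)
    then show "g \<in> blinfun_apply ` cball 0 m"
      using bl by (intro image_eqI[of _ _ "Blinfun g"]) (auto simp: bounded_linear_Blinfun_apply)
  qed
  have sup: "blinfun_apply y \<in> K" if y: "y \<in> cball 0 m" for y
  proof -
    have "\<bar>blinfun_apply y x\<bar> \<le> m * norm x" for x
    proof -
      have "\<bar>blinfun_apply y x\<bar> \<le> norm y * norm x"
        using norm_blinfun[of y x] by simp
      also have "\<dots> \<le> m * norm x"
        using y by (intro mult_right_mono) auto
      finally show ?thesis .
    qed
    then have "blinfun_apply y x \<in> {- (m * norm x)..m * norm x}" for x
      unfolding atLeastAtMost_iff by (metis abs_le_iff minus_le_iff)
    then show ?thesis
      by (auto simp: K_def PiE_iff blinfun.add_right blinfun.scaleR_right)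
  qed
  show ?thesis
    unfolding compactin_def
  proof (intro conjI allI impI)
    fix \<U> :: "('a \<Rightarrow>\<^sub>L real) set set"
    assume \<U>: "(\<forall>U\<in>\<U>. openin weak_star U) \<and> cball 0 m \<subseteq> \<Union>\<U>"
    \<comment> \<open>The cover is transported to the function space, where compactness of
      \<open>K\<close> applies.\<close>
    define \<T> where "\<T> = {T. open T \<and> blinfun_apply -` T \<in> \<U>}"
    have "K \<subseteq> \<Union>\<T>"
    proof
      fix g assume "g \<in> K"
      then obtain y where y: "y \<in> cball 0 m" "g = blinfun_apply y" using sub by blast
      then obtain U where U: "U \<in> \<U>" "y \<in> U" using \<U> by blast
      then obtain T where "open T" "U = blinfun_apply -` T" using \<U> openin_weak_star by blast
      then show "g \<in> \<Union>\<T>" using U y by (auto simp: \<T>_def)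
    qed
    moreover have "open T" if "T \<in> \<T>" for T
      using that by (simp add: \<T>_def)
    ultimately obtain \<F> where \<F>: "\<F> \<subseteq> \<T>" "finite \<F>" "K \<subseteq> \<Union>\<F>"
      using compactE[OF K] by metis
    show "\<exists>\<F>. finite \<F> \<and> \<F> \<subseteq> \<U> \<and> cball 0 m \<subseteq> \<Union>\<F>"
    proof (intro exI[of _ "(-`) blinfun_apply ` \<F>"] conjI)
      show "cball 0 m \<subseteq> \<Union> ((-`) blinfun_apply ` \<F>)"
        using \<F>(3) sup by blast
    qed (use \<F> in \<open>auto simp: \<T>_def\<close>)
  qed simp
qed

subsection \<open>Bounded sets of functionals are fragmented\<close>

text \<open>The support function \<open>\<sigma>\<close> of \<open>K\<close> is convex and
  Lipschitz, hence differentiable at some \<open>x\<close>, with derivative \<open>D\<close>. If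
  \<open>y\<close> in \<open>K\<close> nearly attains \<open>\<sigma> x\<close>, then
  \<open>y (x + k) \<le> \<sigma> (x + k)\<close> forces \<open>y\<close> to be within
  \<open>e / 2\<close> of \<open>D\<close>. Such \<open>y\<close> form a weak* open slice of
  \<open>K\<close>.\<close>

lemma asplund_fragmented:
  fixes K :: "('a::banach \<Rightarrow>\<^sub>L real) set"
  assumes asplund: "asplund_space TYPE('a)" and K: "K \<noteq> {}" "K \<subseteq> cball 0 m" and e: "e > 0"
  shows "\<exists>U. openin weak_star U \<and> K \<inter> U \<noteq> {} \<and> (\<forall>y\<in>K \<inter> U. \<forall>z\<in>K \<inter> U. dist y z \<le> e)"
proof -
  define \<sigma> where "\<sigma> x = (SUP y\<in>K. blinfun_apply y x)" for x
  have le: "blinfun_apply y x \<le> m * norm x" if "y \<in> K" for y x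
  proof -
    have "blinfun_apply y x \<le> norm y * norm x"
      using norm_blinfun[of y x] by simp
    also have "\<dots> \<le> m * norm x"
      using that K(2) by (intro mult_right_mono) auto
    finally show ?thesis .
  qed
  have bdd: "bdd_above ((\<lambda>y. blinfun_apply y x) ` K)" for x
    using le by (intro bdd_aboveI2[of _ _ "m * norm x"])
  have upper: "blinfun_apply y x \<le> \<sigma> x" if "y \<in> K" for y x
    unfolding \<sigma>_def by (rule cSUP_upper[OF that bdd])
  have conv: "convex_on UNIV \<sigma>"
  proof (rule convex_onI)
    fix t :: real and x y :: 'a assume t: "0 < t" "t < 1"
    show "\<sigma> ((1 - t) *\<^sub>R x + t *\<^sub>R y) \<le> (1 - t) * \<sigma> x + t * \<sigma> y"
      unfolding \<sigma>_def[of "(1 - t) *\<^sub>R x + t *\<^sub>R y"]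
    proof (rule cSUP_least[OF K(1)])
      fix z assume "z \<in> K"
      then show "blinfun_apply z ((1 - t) *\<^sub>R x + t *\<^sub>R y) \<le> (1 - t) * \<sigma> x + t * \<sigma> y"
        using t upper by (auto simp: blinfun.add_right blinfun.scaleR_right intro!: add_mono mult_left_mono)
    qed
  qed simp
  have diff: "\<sigma> x - \<sigma> y \<le> m * norm (x - y)" for x y
  proof -
    have "\<sigma> x \<le> \<sigma> y + m * norm (x - y)"
      unfolding \<sigma>_def[of x]
    proof (rule cSUP_least[OF K(1)])
      fix z assume z: "z \<in> K"
      show "blinfun_apply z x \<le> \<sigma> y + m * norm (x - y)"
        using upper[OF z, of y] le[OF z, of "x - y"] by (simp add: blinfun.diff_right)
    qed
    then show ?thesis by simp
  qed
  have m0: "0 \<le> m" using K norm_ge_zero order_trans by fastforce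
  have "continuous_on UNIV \<sigma>"
    unfolding continuous_on_iff
  proof (intro ballI allI impI)
    fix x :: 'a and \<epsilon> :: real assume \<epsilon>: "\<epsilon> > 0"
    have "dist (\<sigma> y) (\<sigma> x) < \<epsilon>" if "dist y x < \<epsilon> / (m + 1)" for y
    proof -
      have "dist (\<sigma> y) (\<sigma> x) \<le> m * norm (y - x)"
        using diff[of x y] diff[of y x] by (simp add: dist_real_def norm_minus_commute abs_le_iff)
      also have "\<dots> \<le> (m + 1) * norm (y - x)"
        by (intro mult_right_mono) auto
      also have "\<dots> < \<epsilon>"
        using that m0 by (simp add: dist_norm field_simps)
      finally show ?thesis .
    qed
    then show "\<exists>d>0. \<forall>y\<in>UNIV. dist y x < d \<longrightarrow> dist (\<sigma> y) (\<sigma> x) < \<epsilon>"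
      using \<epsilon> m0 by (intro exI[of _ "\<epsilon> / (m + 1)"]) auto
  qed
  then obtain x D where D: "(\<sigma> has_derivative D) (at x)"
    using asplund conv unfolding asplund_space_def differentiable_def by blast
  then obtain d where d: "d > 0"
    "\<And>z. norm (z - x) < d \<Longrightarrow> norm (\<sigma> z - \<sigma> x - D (z - x)) \<le> e / 4 * norm (z - x)"
    unfolding has_derivative_at_alt using e by (meson divide_pos_pos zero_less_numeral)
  have lin: "linear D" using D by (simp add: has_derivative_linear)
  define \<delta> where "\<delta> = d / 2"
  have \<delta>: "\<delta> > 0" "\<delta> < d" using d by (auto simp: \<delta>_def)
  \<comment> \<open>The depth of the slice equals the differentiability error at distance
    \<open>\<delta>\<close>, so that the two add up to \<open>e / 2 * \<delta>\<close>.\<close>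
  define U where "U = {y :: 'a \<Rightarrow>\<^sub>L real. \<sigma> x - e / 4 * \<delta> < blinfun_apply y x}"
  have "K \<inter> U \<noteq> {}"
  proof -
    have "\<sigma> x - e / 4 * \<delta> < \<sigma> x" using e \<delta> by simp
    then show ?thesis
      unfolding \<sigma>_def[of x] U_def using less_cSUP_iff[OF K(1) bdd] by (auto simp: \<sigma>_def)
  qed
  moreover have "dist y z \<le> e" if y: "y \<in> K \<inter> U" and z: "z \<in> K \<inter> U" for y z
  proof -
    have one: "blinfun_apply y h - D h \<le> e / 2 * norm h" if y: "y \<in> K \<inter> U" for y h
    proof (cases "h = 0")
      case False
      define k where "k = (\<delta> / norm h) *\<^sub>R h"
      have nk: "norm k = \<delta>" using False \<delta> by (simp add: k_def)
      have "\<bar>\<sigma> (x + k) - \<sigma> x - D k\<bar> \<le> e / 4 * \<delta>"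
        using d(2)[of "x + k"] nk \<delta> by simp
      then have "\<sigma> (x + k) \<le> \<sigma> x + D k + e / 4 * \<delta>"
        by linarith
      moreover have "blinfun_apply y x + blinfun_apply y k \<le> \<sigma> (x + k)"
        using upper[of y "x + k"] y by (simp add: blinfun.add_right)
      moreover have "\<sigma> x - e / 4 * \<delta> < blinfun_apply y x"
        using y by (simp add: U_def)
      ultimately have "blinfun_apply y k - D k \<le> e / 2 * \<delta>" by simp
      then have "(\<delta> / norm h) * (blinfun_apply y h - D h) \<le> e / 2 * \<delta>"
        using lin by (simp add: k_def linear_cmul blinfun.scaleR_right right_diff_distrib)
      also have "\<dots> = (\<delta> / norm h) * (e / 2 * norm h)"
        using False by simp
      finally show ?thesis
        by (rule mult_left_le_imp_le) (use \<delta> False in simp)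
    qed (use lin in \<open>simp add: linear_0 blinfun.zero_right\<close>)
    have two: "\<bar>blinfun_apply y h - D h\<bar> \<le> e / 2 * norm h" if y: "y \<in> K \<inter> U" for y h
      using one[OF y, of h] one[OF y, of "- h"] lin
      unfolding abs_le_iff by (simp add: linear_neg blinfun.minus_right)
    have "norm (y - z) \<le> e"
    proof (rule norm_blinfun_bound)
      fix h show "norm (blinfun_apply (y - z) h) \<le> e * norm h"
        using two[OF y, of h] two[OF z, of h] unfolding real_norm_def blinfun.diff_left by linarith
    qed (use e in simp)
    then show ?thesis by (simp add: dist_norm)
  qed
  ultimately show ?thesis
    using openin_weak_star_halfspace[of "\<sigma> x - e / 4 * \<delta>" x] unfolding U_def[symmetric] by blast
qed

subsection \<open>Selectors on closed subsets of a fragmented compact space\<close>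

text \<open>Every finite subfamily has a member of the family below its intersection, so the finite
  intersection property holds.\<close>

lemma filtered_closed_Inter_nonempty:
  assumes comp: "compact_space X" and ne: "\<A> \<noteq> {}" and closed: "\<And>A. A \<in> \<A> \<Longrightarrow> closedin X A \<and> A \<noteq> {}"
    and inter: "\<And>A B. A \<in> \<A> \<Longrightarrow> B \<in> \<A> \<Longrightarrow> A \<inter> B \<in> \<A>"
  shows "\<Inter>\<A> \<noteq> {}"
proof -
  have "\<exists>A\<in>\<A>. A \<subseteq> \<Inter>\<F>" if "finite \<F>" "\<F> \<subseteq> \<A>" for \<F>
    using that
  proof (induction \<F>)
    case empty
    then show ?case using ne by auto
  next
    case (insert B \<F>)
    then obtain A where "A \<in> \<A>" "A \<subseteq> \<Inter>\<F>" by auto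
    then show ?case using inter[of A B] insert.prems by (intro bexI[of _ "A \<inter> B"]) auto
  qed
  then have "\<Inter>\<F> \<noteq> {}" if "finite \<F>" "\<F> \<subseteq> \<A>" for \<F>
    using that closed by fastforce
  then show ?thesis
    using comp[unfolded compact_space_fip, rule_format, of \<A>] closed by simp
qed

lemma well_order_on_UNIV_D:
  assumes "well_order_on UNIV r"
  shows "wf (r - Id)" "(v, w) \<in> r \<or> (w, v) \<in> r" "(v, v) \<in> r"
    "(v, w) \<in> r \<Longrightarrow> (w, v) \<in> r \<Longrightarrow> v = w"
    "(u, v) \<in> r \<Longrightarrow> (v, w) \<in> r \<Longrightarrow> (u, w) \<in> r"
proof -
  have r: "wf (r - Id)" "refl r" "trans r" "antisym r" "total r"
    using assms unfolding well_order_on_def linear_order_on_def partial_order_on_def preorder_on_def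
    by blast+
  show "wf (r - Id)" by fact
  show "(v, v) \<in> r" using r(2) by (simp add: refl_on_def)
  then show "(v, w) \<in> r \<or> (w, v) \<in> r"
    using r(5) by (cases "v = w") (auto simp: total_on_def)
  show "(v, w) \<in> r \<Longrightarrow> (w, v) \<in> r \<Longrightarrow> v = w" using r(4) by (rule antisymD)
  show "(u, v) \<in> r \<Longrightarrow> (v, w) \<in> r \<Longrightarrow> (u, w) \<in> r" using r(3) by (rule transD)
qed

text \<open>Peel off relatively open small pieces \<open>S w\<close> by transfinite recursion; the rank of a point is
  the stage at which it is removed. The index type \<open>'b set\<close> is too large for the peeling to go on
  forever, by Cantor's theorem.\<close>

lemma fragmentation_rank:
  fixes X :: "'b topology" and Q :: "'b \<Rightarrow> 'b \<Rightarrow> bool"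
  assumes frag: "\<And>K. K \<noteq> {} \<Longrightarrow> K \<subseteq> topspace X \<Longrightarrow>
    \<exists>U. openin X U \<and> K \<inter> U \<noteq> {} \<and> (\<forall>y\<in>K \<inter> U. \<forall>z\<in>K \<inter> U. Q y z)"
  obtains r :: "'b set rel" and \<rho> :: "'b \<Rightarrow> 'b set" where
    "well_order_on UNIV r"
    "\<And>w. closedin X {y \<in> topspace X. (w, \<rho> y) \<in> r}"
    "\<And>y z. y \<in> topspace X \<Longrightarrow> z \<in> topspace X \<Longrightarrow> \<rho> y = \<rho> z \<Longrightarrow> Q y z"
proof -
  obtain r :: "'b set rel" where r: "well_order_on UNIV r"
    using well_ordering by metis
  note wf = well_order_on_UNIV_D(1)[OF r] and tot = well_order_on_UNIV_D(2)[OF r]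
    and refl = well_order_on_UNIV_D(3)[OF r] and antisym = well_order_on_UNIV_D(4)[OF r]
    and trans = well_order_on_UNIV_D(5)[OF r]
  have "\<exists>U. openin X U \<and> (K \<noteq> {} \<longrightarrow> K \<inter> U \<noteq> {}) \<and> (\<forall>y\<in>K \<inter> U. \<forall>z\<in>K \<inter> U. Q y z)"
    if "K \<subseteq> topspace X" for K
    using frag[of K] that by (cases "K = {}") auto
  then obtain sl where sl: "\<And>K. K \<subseteq> topspace X \<Longrightarrow> openin X (sl K) \<and>
      (K \<noteq> {} \<longrightarrow> K \<inter> sl K \<noteq> {}) \<and> (\<forall>y\<in>K \<inter> sl K. \<forall>z\<in>K \<inter> sl K. Q y z)"
    by metis
  \<comment> \<open>\<open>S w\<close> is the open set used at stage \<open>w\<close>. It meets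
    \<open>K w\<close>, the part left over by the earlier stages, unless that part is empty.\<close>
  define S where "S = wfrec (r - Id) (\<lambda>S w. sl (topspace X - (\<Union>v\<in>{v. (v, w) \<in> r - Id}. S v)))"
  define K where "K w = topspace X - (\<Union>v\<in>{v. (v, w) \<in> r - Id}. S v)" for w
  have S: "S w = sl (K w)" for w
  proof -
    have "S w = sl (topspace X - (\<Union>v\<in>{v. (v, w) \<in> r - Id}. cut S (r - Id) w v))"
      unfolding S_def by (subst wfrec[OF wf]) simp
    also have "(\<Union>v\<in>{v. (v, w) \<in> r - Id}. cut S (r - Id) w v) = (\<Union>v\<in>{v. (v, w) \<in> r - Id}. S v)"
      by (intro SUP_cong) (auto simp: cut_def)
    finally show ?thesis by (simp add: K_def)
  qed
  have K_sub: "K w \<subseteq> topspace X" for w by (auto simp: K_def)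
  \<comment> \<open>If \<open>y\<close> is never removed, every stage removes a new point
    \<open>p w\<close>. This embeds the power set of \<open>'b\<close> into
    \<open>'b\<close>.\<close>
  have cover: "\<exists>w. y \<in> S w" if y: "y \<in> topspace X" for y
  proof (rule ccontr)
    assume "\<not> ?thesis"
    then have "y \<in> K w" for w using y by (auto simp: K_def)
    then have "\<exists>p. p \<in> K w \<inter> S w" for w
      using sl[OF K_sub, of w] S by blast
    then obtain p where p: "\<And>w. p w \<in> K w \<inter> S w" by metis
    have "p v \<noteq> p w" if "(v, w) \<in> r" "v \<noteq> w" for v w
      using p[of v] p[of w] that by (auto simp: K_def)
    then have "inj p" using tot by (metis injI)
    then have "range (inv p) = Pow UNIV" using inj_imp_surj_inv by auto
    then show False using Cantors_theorem by metis
  qed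
  have "\<exists>w. y \<in> S w \<and> (\<forall>v. y \<in> S v \<longrightarrow> (w, v) \<in> r)" if y: "y \<in> topspace X" for y
  proof -
    obtain w where "w \<in> {w. y \<in> S w}" "\<And>v. (v, w) \<in> r - Id \<Longrightarrow> v \<notin> {w. y \<in> S w}"
      using cover[OF y] wfE_min[OF wf, of _ "{w. y \<in> S w}"] by (metis mem_Collect_eq)
    then show ?thesis using tot refl by (intro exI[of _ w]) (metis DiffI mem_Collect_eq pair_in_Id_conv)
  qed
  then obtain \<rho> where \<rho>: "\<And>y. y \<in> topspace X \<Longrightarrow> y \<in> S (\<rho> y)"
    "\<And>y v. y \<in> topspace X \<Longrightarrow> y \<in> S v \<Longrightarrow> (\<rho> y, v) \<in> r"
    by metis
  \<comment> \<open>The part left before stage \<open>w\<close> consists of the points of rank at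
    least \<open>w\<close>; this makes the upper level sets of the rank closed.\<close>
  have K_eq: "{y \<in> topspace X. (w, \<rho> y) \<in> r} = K w" for w
  proof
    show "{y \<in> topspace X. (w, \<rho> y) \<in> r} \<subseteq> K w"
    proof
      fix y assume y: "y \<in> {y \<in> topspace X. (w, \<rho> y) \<in> r}"
      have "y \<notin> S v" if "(v, w) \<in> r" "v \<noteq> w" for v
        using y \<rho>(2)[of y v] that trans antisym by blast
      then show "y \<in> K w" using y by (auto simp: K_def)
    qed
    show "K w \<subseteq> {y \<in> topspace X. (w, \<rho> y) \<in> r}"
    proof
      fix y assume y: "y \<in> K w"
      then have top: "y \<in> topspace X" by (simp add: K_def)
      then have "\<not> (\<rho> y, w) \<in> r - Id" using y \<rho>(1)[OF top] by (auto simp: K_def)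
      then show "y \<in> {y \<in> topspace X. (w, \<rho> y) \<in> r}" using top tot refl by blast
    qed
  qed
  show thesis
  proof (rule that[OF r])
    fix w
    have "openin X (\<Union>v\<in>{v. (v, w) \<in> r - Id}. S v)"
      using sl[OF K_sub] S by (intro openin_Union) auto
    then show "closedin X {y \<in> topspace X. (w, \<rho> y) \<in> r}"
      unfolding K_eq K_def by (rule openin_closedin_eq[THEN iffD1, THEN conjunct2])
  next
    fix y z assume yz: "y \<in> topspace X" "z \<in> topspace X" "\<rho> y = \<rho> z"
    then have "y \<in> K (\<rho> y)" "z \<in> K (\<rho> y)"
      using refl by (auto simp flip: K_eq)
    then show "Q y z"
      using sl[OF K_sub, of "\<rho> y"] S yz \<rho>(1) by (metis IntI)
  qed
qed

text \<open>By compactness a nonempty closed set attains a maximal rank, and the selection depends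
  on that rank alone. Given a filtered family, let \<open>A0\<close> have the least maximal rank
  \<open>w0\<close>. Every member has a point of rank at least \<open>w0\<close>, so by compactness
  the intersection does too, and all sets between the intersection and \<open>A0\<close> have
  maximal rank \<open>w0\<close>.\<close>

lemma fragmented_compact_selector:
  fixes X :: "'b topology" and Q :: "'b \<Rightarrow> 'b \<Rightarrow> bool"
  assumes comp: "compact_space X"
    and frag: "\<And>K. K \<noteq> {} \<Longrightarrow> K \<subseteq> topspace X \<Longrightarrow>
    \<exists>U. openin X U \<and> K \<inter> U \<noteq> {} \<and> (\<forall>y\<in>K \<inter> U. \<forall>z\<in>K \<inter> U. Q y z)"
  obtains sel :: "'b set \<Rightarrow> 'b" where
    "\<And>A. closedin X A \<Longrightarrow> A \<noteq> {} \<Longrightarrow> \<exists>y\<in>A. Q (sel A) y"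
    "\<And>\<A>. \<A> \<noteq> {} \<Longrightarrow> (\<And>A. A \<in> \<A> \<Longrightarrow> closedin X A) \<Longrightarrow>
      (\<And>A B. A \<in> \<A> \<Longrightarrow> B \<in> \<A> \<Longrightarrow> A \<inter> B \<in> \<A>) \<Longrightarrow> \<Inter>\<A> \<noteq> {} \<Longrightarrow>
      \<exists>A0\<in>\<A>. \<forall>A. \<Inter>\<A> \<subseteq> A \<and> A \<subseteq> A0 \<longrightarrow> sel A = sel (\<Inter>\<A>)"
proof -
  obtain r :: "'b set rel" and \<rho> where r: "well_order_on UNIV r"
    and closed: "\<And>w. closedin X {y \<in> topspace X. (w, \<rho> y) \<in> r}"
    and Q: "\<And>y z. y \<in> topspace X \<Longrightarrow> z \<in> topspace X \<Longrightarrow> \<rho> y = \<rho> z \<Longrightarrow> Q y z"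
  proof (rule fragmentation_rank[of X Q])
    show "\<exists>U. openin X U \<and> K \<inter> U \<noteq> {} \<and> (\<forall>y\<in>K \<inter> U. \<forall>z\<in>K \<inter> U. Q y z)"
      if "K \<noteq> {}" "K \<subseteq> topspace X" for K
      using that by (rule frag)
  qed (rule that)
  note wf = well_order_on_UNIV_D(1)[OF r] and tot = well_order_on_UNIV_D(2)[OF r]
    and refl = well_order_on_UNIV_D(3)[OF r] and antisym = well_order_on_UNIV_D(4)[OF r]
    and trans = well_order_on_UNIV_D(5)[OF r]
  define R where "R w = {y \<in> topspace X. (w, \<rho> y) \<in> r}" for w
  have R: "closedin X (R w)" for w using closed by (simp add: R_def)
  have R_Int: "R v \<inter> R w = R v \<or> R v \<inter> R w = R w" for v w
    using tot[of v w] trans by (auto simp: R_def)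
  define is_top where "is_top A w \<longleftrightarrow> w \<in> \<rho> ` A \<and> (\<forall>y\<in>A. (\<rho> y, w) \<in> r)" for A w
  have top_unique: "v = w" if "is_top A v" "is_top A w" for A v w
    using that antisym by (auto simp: is_top_def)
  have top_exists: "\<exists>w. is_top A w" if A: "closedin X A" "A \<noteq> {}" for A
  proof -
    have sub: "A \<subseteq> topspace X" using A closedin_subset by blast
    have "\<Inter>((\<lambda>w. A \<inter> R w) ` \<rho> ` A) \<noteq> {}"
    proof (rule filtered_closed_Inter_nonempty[OF comp])
      show "closedin X B \<and> B \<noteq> {}" if "B \<in> (\<lambda>w. A \<inter> R w) ` \<rho> ` A" for B
        using that A R refl sub by (auto simp: R_def)
      show "B \<inter> B' \<in> (\<lambda>w. A \<inter> R w) ` \<rho> ` A"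
        if B: "B \<in> (\<lambda>w. A \<inter> R w) ` \<rho> ` A" and B': "B' \<in> (\<lambda>w. A \<inter> R w) ` \<rho> ` A" for B B'
      proof -
        obtain v w where "v \<in> \<rho> ` A" "w \<in> \<rho> ` A" and BB': "B = A \<inter> R v" "B' = A \<inter> R w"
          using B B' by blast
        then have "B \<inter> B' = B \<or> B \<inter> B' = B'" using R_Int[of v w] by blast
        then show ?thesis using B B' by metis
      qed
    qed (use A in auto)
    then show ?thesis using A(2) by (auto simp: is_top_def R_def)
  qed
  \<comment> \<open>The choice ranges over the whole space, so the value may lie outside
    \<open>A\<close>; sets with the same maximal rank get the same value.\<close>
  define sel where "sel A = (SOME y. y \<in> topspace X \<and> is_top A (\<rho> y))" for A
  have sel: "sel A \<in> topspace X \<and> is_top A (\<rho> (sel A))" if "is_top A w" "A \<subseteq> topspace X" for A w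
    unfolding sel_def by (rule someI_ex) (use that in \<open>auto simp: is_top_def\<close>)
  have sel_cong: "sel A = sel B" if "is_top A w" "is_top B w" for A B w
  proof -
    have "is_top A v = is_top B v" for v using that top_unique by metis
    then show ?thesis by (simp add: sel_def)
  qed
  show thesis
  proof (rule that)
    fix A assume A: "closedin X A" "A \<noteq> {}"
    have sub: "A \<subseteq> topspace X" using A closedin_subset by blast
    have s: "sel A \<in> topspace X" "is_top A (\<rho> (sel A))"
      using top_exists[OF A] sel sub by blast+
    then obtain y where "y \<in> A" "\<rho> (sel A) = \<rho> y" unfolding is_top_def by blast
    then show "\<exists>y\<in>A. Q (sel A) y" using Q s sub by blast
  next
    fix \<A> :: "'b set set"
    assume ne: "\<A> \<noteq> {}" and cl: "\<And>A. A \<in> \<A> \<Longrightarrow> closedin X A"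
      and int: "\<And>A B. A \<in> \<A> \<Longrightarrow> B \<in> \<A> \<Longrightarrow> A \<inter> B \<in> \<A>" and Int_ne: "\<Inter>\<A> \<noteq> {}"
    define W where "W = {w. \<exists>A\<in>\<A>. is_top A w}"
    have tops: "\<exists>w. is_top A w" if "A \<in> \<A>" for A
      using top_exists[OF cl[OF that]] that Int_ne by blast
    then have "W \<noteq> {}" using ne unfolding W_def by blast
    then obtain w0 where "w0 \<in> W" "\<And>v. (v, w0) \<in> r - Id \<Longrightarrow> v \<notin> W"
      using wfE_min[OF wf] by (metis ex_in_conv)
    then have least: "w0 \<in> W" "\<And>v. v \<in> W \<Longrightarrow> (w0, v) \<in> r"
      using tot refl by (metis, metis DiffI pair_in_Id_conv)
    then obtain A0 where A0: "A0 \<in> \<A>" "is_top A0 w0" by (auto simp: W_def)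
    have "\<Inter>((\<lambda>A. A \<inter> R w0) ` \<A>) \<noteq> {}"
    proof (rule filtered_closed_Inter_nonempty[OF comp])
      show "closedin X B \<and> B \<noteq> {}" if B: "B \<in> (\<lambda>A. A \<inter> R w0) ` \<A>" for B
      proof -
        obtain A where A: "A \<in> \<A>" "B = A \<inter> R w0" using B by blast
        obtain w where w: "is_top A w" using tops A by blast
        then have "(w0, w) \<in> r" using least(2) A by (auto simp: W_def)
        moreover obtain y where "y \<in> A" "\<rho> y = w" using w by (auto simp: is_top_def)
        ultimately have "y \<in> B"
          using A cl[OF A(1)] closedin_subset by (fastforce simp: R_def)
        then show ?thesis using A cl R by auto
      qed
      show "B \<inter> B' \<in> (\<lambda>A. A \<inter> R w0) ` \<A>"
        if BB: "B \<in> (\<lambda>A. A \<inter> R w0) ` \<A>" "B' \<in> (\<lambda>A. A \<inter> R w0) ` \<A>" for B B'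
      proof -
        obtain A A' where "A \<in> \<A>" "A' \<in> \<A>" "B = A \<inter> R w0" "B' = A' \<inter> R w0"
          using BB by blast
        then show ?thesis using int by (intro image_eqI[of _ _ "A \<inter> A'"]) auto
      qed
    qed (use ne in auto)
    then obtain y where y: "y \<in> \<Inter>\<A>" "(w0, \<rho> y) \<in> r" using ne by (auto simp: R_def)
    then have "\<rho> y = w0" using A0 antisym by (auto simp: is_top_def)
    then have "is_top A w0" if "\<Inter>\<A> \<subseteq> A" "A \<subseteq> A0" for A
      using that y(1) A0(2) by (auto simp: is_top_def)
    moreover have "\<Inter>\<A> \<subseteq> A0" using A0 by blast
    ultimately show "\<exists>A0\<in>\<A>. \<forall>A. \<Inter>\<A> \<subseteq> A \<and> A \<subseteq> A0 \<longrightarrow> sel A = sel (\<Inter>\<A>)"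
      using sel_cong A0(1) by (metis order_refl)
  qed
qed

subsection \<open>Asplund spaces have Asplund generators\<close>

text \<open>Rational bounds leave only countably many finite \<open>F\<close> over a countable set
  of points. Constraints on \<open>- x\<close> provide lower bounds at \<open>x\<close>. Keeping
  \<open>F\<close> as data allows points and bounds to be perturbed.\<close>

definition weak_star_polytope :: "real \<Rightarrow> ('a::real_normed_vector \<times> rat) set \<Rightarrow> ('a \<Rightarrow>\<^sub>L real) set" where
  "weak_star_polytope m F = {y \<in> cball 0 m. \<forall>(x, q)\<in>F. blinfun_apply y x \<le> real_of_rat q}"

lemma weak_star_polytope_Un:
  "weak_star_polytope m (F \<union> F') = weak_star_polytope m F \<inter> weak_star_polytope m F'"
  by (auto simp: weak_star_polytope_def)

lemma closedin_weak_star_polytope: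
  "closedin (subtopology weak_star (cball 0 m)) (weak_star_polytope m F)"
proof -
  \<comment> \<open>Inserting \<open>UNIV\<close> keeps the family nonempty when \<open>F\<close> is
    empty, as intersections of closed sets require.\<close>
  have "weak_star_polytope m F
      = \<Inter> (insert UNIV ((\<lambda>(x, q). {y. blinfun_apply y x \<le> real_of_rat q}) ` F)) \<inter> cball 0 m"
    by (auto simp: weak_star_polytope_def)
  moreover have "closedin weak_star (\<Inter> (insert UNIV ((\<lambda>(x, q). {y :: 'a \<Rightarrow>\<^sub>L real. blinfun_apply y x \<le> real_of_rat q}) ` F)))"
    using closedin_topspace[of "weak_star :: ('a \<Rightarrow>\<^sub>L real) topology"]
    by (intro closedin_Inter) (auto simp: closedin_weak_star_halfspace)
  ultimately show ?thesis
    unfolding closedin_subtopology by blast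
qed

text \<open>The two properties of \<open>fragmented_compact_selector\<close> on the ball of radius
  \<open>m\<close>: accuracy \<open>e\<close>, and stabilisation along families of closed sets
  stable under intersection.\<close>

definition weak_star_selector :: "real \<Rightarrow> real \<Rightarrow> (('a::real_normed_vector \<Rightarrow>\<^sub>L real) set \<Rightarrow> ('a \<Rightarrow>\<^sub>L real)) \<Rightarrow> bool" where
  "weak_star_selector m e sel \<longleftrightarrow>
     (\<forall>A. closedin (subtopology weak_star (cball 0 m)) A \<and> A \<noteq> {} \<longrightarrow> (\<exists>y\<in>A. dist (sel A) y \<le> e)) \<and>
     (\<forall>\<A>. \<A> \<noteq> {} \<and> (\<forall>A\<in>\<A>. closedin (subtopology weak_star (cball 0 m)) A) \<and>
        (\<forall>A\<in>\<A>. \<forall>B\<in>\<A>. A \<inter> B \<in> \<A>) \<and> \<Inter>\<A> \<noteq> {} \<longrightarrow>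
        (\<exists>A0\<in>\<A>. \<forall>A. \<Inter>\<A> \<subseteq> A \<and> A \<subseteq> A0 \<longrightarrow> sel A = sel (\<Inter>\<A>)))"

lemma weak_star_selector_exists:
  assumes asplund: "asplund_space TYPE('a::banach)" and m: "0 \<le> m" and e: "0 < e"
  obtains sel :: "('a::banach \<Rightarrow>\<^sub>L real) set \<Rightarrow> ('a \<Rightarrow>\<^sub>L real)" where "weak_star_selector m e sel"
proof -
  define X where "X = subtopology weak_star (cball 0 m :: ('a \<Rightarrow>\<^sub>L real) set)"
  have comp: "compact_space X"
    using compactin_weak_star_cball[OF m] by (simp add: X_def compactin_subspace)
  have frag: "\<exists>U. openin X U \<and> K \<inter> U \<noteq> {} \<and> (\<forall>y\<in>K \<inter> U. \<forall>z\<in>K \<inter> U. dist y z \<le> e)"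
    if K: "K \<noteq> {}" "K \<subseteq> topspace X" for K
  proof -
    have sub: "K \<subseteq> cball 0 m" using K by (simp add: X_def)
    obtain U where U: "openin weak_star U" "K \<inter> U \<noteq> {}" "\<And>y z. y \<in> K \<inter> U \<Longrightarrow> z \<in> K \<inter> U \<Longrightarrow> dist y z \<le> e"
      using asplund_fragmented[OF asplund K(1) sub e] by blast
    have "openin X (U \<inter> cball 0 m)"
      using U(1) by (auto simp: X_def openin_subtopology)
    moreover have "K \<inter> (U \<inter> cball 0 m) = K \<inter> U" using sub by blast
    ultimately show ?thesis using U by metis
  qed
  show thesis
  proof (rule fragmented_compact_selector[OF comp, of "\<lambda>y z. dist y z \<le> e"])
    show "\<exists>U. openin X U \<and> K \<inter> U \<noteq> {} \<and> (\<forall>y\<in>K \<inter> U. \<forall>z\<in>K \<inter> U. dist y z \<le> e)"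
      if "K \<noteq> {}" "K \<subseteq> topspace X" for K
      using that by (rule frag)
  next
    fix sel :: "('a \<Rightarrow>\<^sub>L real) set \<Rightarrow> ('a \<Rightarrow>\<^sub>L real)"
    assume sel: "\<And>A. closedin X A \<Longrightarrow> A \<noteq> {} \<Longrightarrow> \<exists>y\<in>A. dist (sel A) y \<le> e"
      "\<And>\<A>. \<A> \<noteq> {} \<Longrightarrow> (\<And>A. A \<in> \<A> \<Longrightarrow> closedin X A) \<Longrightarrow>
        (\<And>A B. A \<in> \<A> \<Longrightarrow> B \<in> \<A> \<Longrightarrow> A \<inter> B \<in> \<A>) \<Longrightarrow> \<Inter>\<A> \<noteq> {} \<Longrightarrow>
        \<exists>A0\<in>\<A>. \<forall>A. \<Inter>\<A> \<subseteq> A \<and> A \<subseteq> A0 \<longrightarrow> sel A = sel (\<Inter>\<A>)"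
    have "weak_star_selector m e sel"
      unfolding weak_star_selector_def X_def[symmetric]
    proof (intro conjI allI impI)
      fix A assume "closedin X A \<and> A \<noteq> {}"
      then show "\<exists>y\<in>A. dist (sel A) y \<le> e" using sel(1) by simp
    next
      fix \<A> assume "\<A> \<noteq> {} \<and> (\<forall>A\<in>\<A>. closedin X A) \<and> (\<forall>A\<in>\<A>. \<forall>B\<in>\<A>. A \<inter> B \<in> \<A>) \<and> \<Inter>\<A> \<noteq> {}"
      then show "\<exists>A0\<in>\<A>. \<forall>A. \<Inter>\<A> \<subseteq> A \<and> A \<subseteq> A0 \<longrightarrow> sel A = sel (\<Inter>\<A>)"
        by (intro sel(2)) auto
    qed
    then show thesis by (rule that)
  qed
qed

lemma weak_star_selectorD1:
  assumes "weak_star_selector m e sel" "closedin (subtopology weak_star (cball 0 m)) A" "A \<noteq> {}"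
  obtains y where "y \<in> A" "dist (sel A) y \<le> e"
  using assms unfolding weak_star_selector_def by metis

lemma weak_star_selectorD2:
  assumes "weak_star_selector m e sel" "\<A> \<noteq> {}"
    and "\<And>A. A \<in> \<A> \<Longrightarrow> closedin (subtopology weak_star (cball 0 m)) A"
    and "\<And>A B. A \<in> \<A> \<Longrightarrow> B \<in> \<A> \<Longrightarrow> A \<inter> B \<in> \<A>" and "\<Inter>\<A> \<noteq> {}"
  obtains A0 where "A0 \<in> \<A>" "\<And>A. \<Inter>\<A> \<subseteq> A \<Longrightarrow> A \<subseteq> A0 \<Longrightarrow> sel A = sel (\<Inter>\<A>)"
proof -
  have "\<exists>A0\<in>\<A>. \<forall>A. \<Inter>\<A> \<subseteq> A \<and> A \<subseteq> A0 \<longrightarrow> sel A = sel (\<Inter>\<A>)"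
    using assms(1)[unfolded weak_star_selector_def, THEN conjunct2, rule_format, of \<A>] assms(2-5) by blast
  then show thesis using that by blast
qed

text \<open>Every member of the intersection of all finite polytopes over \<open>C\<close>
  containing \<open>y0\<close> agrees with \<open>y0\<close> on \<open>closed_span C\<close>. By
  stabilisation some single polytope already has the selection of this intersection, which is within
  \<open>e\<close> of one of its members.\<close>

lemma selector_approximation:
  fixes sel :: "('a::banach \<Rightarrow>\<^sub>L real) set \<Rightarrow> ('a \<Rightarrow>\<^sub>L real)"
  assumes sel: "weak_star_selector m e sel" and y0: "norm y0 \<le> m"
  obtains F y where "finite F" "F \<subseteq> rational_span C \<times> UNIV" "y0 \<in> weak_star_polytope m F"
    "\<And>x. x \<in> closed_span C \<Longrightarrow> blinfun_apply y x = blinfun_apply y0 x"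
    "dist (sel (weak_star_polytope m F)) y \<le> e"
proof -
  define \<F> where "\<F> = {F. finite F \<and> F \<subseteq> rational_span C \<times> UNIV \<and> y0 \<in> weak_star_polytope m F}"
  define \<A> where "\<A> = weak_star_polytope m ` \<F>"
  have F0: "{} \<in> \<F>" using y0 by (simp add: \<F>_def weak_star_polytope_def)
  have y0A: "y0 \<in> \<Inter>\<A>" by (auto simp: \<A>_def \<F>_def)
  have cl: "closedin (subtopology weak_star (cball 0 m)) A" if "A \<in> \<A>" for A
    using that closedin_weak_star_polytope by (auto simp: \<A>_def)
  have int: "A \<inter> B \<in> \<A>" if "A \<in> \<A>" "B \<in> \<A>" for A B
  proof -
    obtain F F' where "F \<in> \<F>" "F' \<in> \<F>" "A = weak_star_polytope m F" "B = weak_star_polytope m F'"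
      using \<open>A \<in> \<A>\<close> \<open>B \<in> \<A>\<close> by (auto simp: \<A>_def)
    moreover from this have "F \<union> F' \<in> \<F>" by (auto simp: \<F>_def weak_star_polytope_Un)
    ultimately show ?thesis by (auto simp: \<A>_def weak_star_polytope_Un[symmetric])
  qed
  have Ane: "\<A> \<noteq> {}" using F0 by (auto simp: \<A>_def)
  have ne: "\<Inter>\<A> \<noteq> {}" using y0A by blast
  obtain A0 where A0: "A0 \<in> \<A>" "\<And>A. \<Inter>\<A> \<subseteq> A \<Longrightarrow> A \<subseteq> A0 \<Longrightarrow> sel A = sel (\<Inter>\<A>)"
    using weak_star_selectorD2[OF sel Ane cl int ne] by blast
  obtain F where F: "F \<in> \<F>" "A0 = weak_star_polytope m F"
    using A0(1) by (auto simp: \<A>_def)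
  have eq: "sel A0 = sel (\<Inter>\<A>)"
    using A0 by (metis Inter_lower order_refl)
  obtain y where y: "y \<in> \<Inter>\<A>" "dist (sel (\<Inter>\<A>)) y \<le> e"
    using weak_star_selectorD1[OF sel closedin_Inter[OF Ane cl] ne] by blast
  have le: "blinfun_apply y x \<le> blinfun_apply y0 x" if x: "x \<in> rational_span C" for x
  proof (rule ccontr)
    assume "\<not> ?thesis"
    then obtain r where "r \<in> \<rat>" "blinfun_apply y0 x < r" "r < blinfun_apply y x"
      using Rats_dense_in_real by (meson not_le)
    then obtain q where q: "blinfun_apply y0 x < real_of_rat q" "real_of_rat q < blinfun_apply y x"
      by (auto elim: Rats_cases)
    have "{(x, q)} \<in> \<F>" using x y0 q by (auto simp: \<F>_def weak_star_polytope_def)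
    then have "y \<in> weak_star_polytope m {(x, q)}" using y(1) by (auto simp: \<A>_def)
    then show False using q by (auto simp: weak_star_polytope_def)
  qed
  have "blinfun_apply y x = blinfun_apply y0 x" if "x \<in> rational_span C" for x
  proof -
    have "- x \<in> rational_span C" using rational_span_scale[OF that, of "-1"] by simp
    then show ?thesis using le[OF that] le[of "- x"] by (simp add: blinfun.minus_right)
  qed
  then have "rational_span C \<subseteq> {x. blinfun_apply y x = blinfun_apply y0 x}" by blast
  moreover have "closed {x. blinfun_apply y x = blinfun_apply y0 x}"
    by (intro closed_Collect_eq continuous_intros)
  ultimately have "closed_span C \<subseteq> {x. blinfun_apply y x = blinfun_apply y0 x}"
    unfolding closure_rational_span[symmetric] by (rule closure_minimal)
  then show thesis
    using F y eq by (intro that[of F y]) (auto simp: \<F>_def)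
qed

text \<open>Relaxing all bounds \<open>q\<close> by \<open>\<delta>\<close> does not change the selection when \<open>\<delta>\<close> is small, and
  leaves room for moving the points \<open>x\<close>.\<close>

lemma selector_perturbation:
  fixes sel :: "('a::banach \<Rightarrow>\<^sub>L real) set \<Rightarrow> ('a \<Rightarrow>\<^sub>L real)"
  assumes sel: "weak_star_selector m e sel" and m: "0 \<le> m"
    and F: "finite F" "F \<subseteq> closed_span D \<times> UNIV" "weak_star_polytope m F \<noteq> {}"
  obtains F' where "finite F'" "F' \<subseteq> rational_span D \<times> UNIV" "weak_star_polytope m F' \<noteq> {}"
    "sel (weak_star_polytope m F') = sel (weak_star_polytope m F)"
proof -
  define P where "P \<delta> = weak_star_polytope m ((\<lambda>(x, q). (x, q + \<delta>)) ` F)" for \<delta>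
  have P: "y \<in> P \<delta> \<longleftrightarrow> y \<in> cball 0 m \<and> (\<forall>(x, q)\<in>F. blinfun_apply y x \<le> real_of_rat q + real_of_rat \<delta>)" for y \<delta>
    by (force simp: P_def weak_star_polytope_def of_rat_add)
  define \<A> where "\<A> = P ` {0<..}"
  have P_mono: "P \<delta> \<subseteq> P \<delta>'" if "\<delta> \<le> \<delta>'" for \<delta> \<delta>'
  proof
    fix y assume y: "y \<in> P \<delta>"
    have "real_of_rat \<delta> \<le> real_of_rat \<delta>'" using that by (simp add: of_rat_less_eq)
    then show "y \<in> P \<delta>'" using y unfolding P by fastforce
  qed
  have Inter: "\<Inter>\<A> = weak_star_polytope m F"
  proof
    show "weak_star_polytope m F \<subseteq> \<Inter>\<A>"
      unfolding \<A>_def weak_star_polytope_def using P by (fastforce intro: add_increasing2)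
    show "\<Inter>\<A> \<subseteq> weak_star_polytope m F"
    proof
      fix y assume "y \<in> \<Inter>\<A>"
      then have y: "y \<in> P \<delta>" if "\<delta> > 0" for \<delta> using that by (auto simp: \<A>_def)
      have "blinfun_apply y x \<le> real_of_rat q" if xq: "(x, q) \<in> F" for x q
      proof (rule field_le_epsilon)
        fix \<epsilon> :: real assume "\<epsilon> > 0"
        then obtain \<delta> where \<delta>: "0 < real_of_rat \<delta>" "real_of_rat \<delta> < \<epsilon>"
          using Rats_dense_in_real[of 0 \<epsilon>] by (auto elim: Rats_cases)
        have "blinfun_apply y x \<le> real_of_rat q + real_of_rat \<delta>"
          using y[of \<delta>] \<delta>(1) xq unfolding P by auto
        then show "blinfun_apply y x \<le> real_of_rat q + \<epsilon>" using \<delta> by linarith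
      qed
      moreover have "y \<in> cball 0 m" using y[of 1] unfolding P by simp
      ultimately show "y \<in> weak_star_polytope m F" unfolding weak_star_polytope_def by blast
    qed
  qed
  obtain A0 where A0: "A0 \<in> \<A>" "\<And>A. \<Inter>\<A> \<subseteq> A \<Longrightarrow> A \<subseteq> A0 \<Longrightarrow> sel A = sel (\<Inter>\<A>)"
  proof (rule weak_star_selectorD2[OF sel, of \<A>])
    show "\<A> \<noteq> {}" by (auto simp: \<A>_def intro: exI[of _ 1])
    show "closedin (subtopology weak_star (cball 0 m)) A" if "A \<in> \<A>" for A
      using that closedin_weak_star_polytope by (auto simp: \<A>_def P_def)
    show "A \<inter> B \<in> \<A>" if AB: "A \<in> \<A>" "B \<in> \<A>" for A B
    proof -
      obtain a b where "a > 0" "b > 0" "A = P a" "B = P b"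
        using AB by (auto simp: \<A>_def)
      then have "A \<inter> B = A \<or> A \<inter> B = B"
        using P_mono[of a b] P_mono[of b a] by (cases "a \<le> b") auto
      then show ?thesis using AB by metis
    qed
    show "\<Inter>\<A> \<noteq> {}" using F(3) Inter by simp
  qed (rule that)
  obtain \<delta> where \<delta>: "\<delta> > 0" "A0 = P \<delta>" using A0(1) by (auto simp: \<A>_def)
  \<comment> \<open>Half of the slack pays for replacing \<open>x\<close> by a nearby point, the
    other half for going back. The new polytope thus lies between the original one and
    \<open>P \<delta>\<close>.\<close>
  define \<eta> where "\<eta> = \<delta> / 2"
  have \<eta>: "real_of_rat \<eta> > 0" "real_of_rat \<delta> = real_of_rat \<eta> + real_of_rat \<eta>"
    using \<delta> by (auto simp: \<eta>_def of_rat_divide)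
  \<comment> \<open>A displacement below \<open>\<eta> / (m + 1)\<close> changes the value of a
    functional of norm at most \<open>m\<close> by at most \<open>\<eta>\<close>.\<close>
  have "\<exists>x'\<in>rational_span D. dist x' x < real_of_rat \<eta> / (m + 1)" if "x \<in> closed_span D" for x
  proof -
    have "real_of_rat \<eta> / (m + 1) > 0" using \<eta>(1) m by simp
    then show ?thesis
      using that unfolding closure_rational_span[symmetric] closure_approachable by blast
  qed
  then obtain \<phi> where \<phi>: "\<And>x. x \<in> closed_span D \<Longrightarrow> \<phi> x \<in> rational_span D"
    "\<And>x. x \<in> closed_span D \<Longrightarrow> dist (\<phi> x) x < real_of_rat \<eta> / (m + 1)"
    by metis
  have close: "\<bar>blinfun_apply y (\<phi> x) - blinfun_apply y x\<bar> \<le> real_of_rat \<eta>"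
    if "x \<in> closed_span D" "y \<in> cball 0 m" for x and y :: "'a \<Rightarrow>\<^sub>L real"
  proof -
    have "\<bar>blinfun_apply y (\<phi> x) - blinfun_apply y x\<bar> \<le> norm y * dist (\<phi> x) x"
      using norm_blinfun[of y "\<phi> x - x"] by (simp add: blinfun.diff_right dist_norm)
    also have "\<dots> \<le> (m + 1) * (real_of_rat \<eta> / (m + 1))"
      using that \<phi>(2)[of x] m by (intro mult_mono) auto
    also have "\<dots> = real_of_rat \<eta>" using m by simp
    finally show ?thesis .
  qed
  define F' where "F' = (\<lambda>(x, q). (\<phi> x, q + \<eta>)) ` F"
  have F': "y \<in> weak_star_polytope m F' \<longleftrightarrow>
      y \<in> cball 0 m \<and> (\<forall>(x, q)\<in>F. blinfun_apply y (\<phi> x) \<le> real_of_rat q + real_of_rat \<eta>)" for y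
    by (force simp: F'_def weak_star_polytope_def of_rat_add)
  have lower: "weak_star_polytope m F \<subseteq> weak_star_polytope m F'"
  proof
    fix y assume y: "y \<in> weak_star_polytope m F"
    then have "y \<in> cball 0 m" by (simp add: weak_star_polytope_def)
    moreover have "blinfun_apply y (\<phi> x) \<le> real_of_rat q + real_of_rat \<eta>" if xq: "(x, q) \<in> F" for x q
    proof -
      have "blinfun_apply y x \<le> real_of_rat q" using y xq by (auto simp: weak_star_polytope_def)
      moreover have "x \<in> closed_span D" using xq F(2) by blast
      ultimately show ?thesis using close[of x y] \<open>y \<in> cball 0 m\<close> by linarith
    qed
    ultimately show "y \<in> weak_star_polytope m F'" unfolding F' by blast
  qed
  have upper: "weak_star_polytope m F' \<subseteq> P \<delta>"
  proof
    fix y assume y: "y \<in> weak_star_polytope m F'"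
    then have "y \<in> cball 0 m" by (simp add: F')
    moreover have "blinfun_apply y x \<le> real_of_rat q + real_of_rat \<delta>" if xq: "(x, q) \<in> F" for x q
    proof -
      have "blinfun_apply y (\<phi> x) \<le> real_of_rat q + real_of_rat \<eta>" using y xq unfolding F' by auto
      moreover have "x \<in> closed_span D" using xq F(2) by blast
      ultimately show ?thesis using close[of x y] \<open>y \<in> cball 0 m\<close> \<eta>(2) by linarith
    qed
    ultimately show "y \<in> P \<delta>" unfolding P by blast
  qed
  show thesis
  proof (rule that[of F'])
    show "finite F'" using F(1) by (simp add: F'_def)
    show "F' \<subseteq> rational_span D \<times> UNIV" using F(2) \<phi>(1) by (auto simp: F'_def)
    show "weak_star_polytope m F' \<noteq> {}" using lower F(3) by blast
    show "sel (weak_star_polytope m F') = sel (weak_star_polytope m F)"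
      using A0(2)[of "weak_star_polytope m F'"] lower upper \<delta>(2) Inter by simp
  qed
qed

lemma finite_subset_incseq_Union:
  fixes C :: "nat \<Rightarrow> 'a set"
  assumes inc: "\<And>i. C i \<subseteq> C (Suc i)" and "finite F" "F \<subseteq> (\<Union>i. C i)"
  shows "\<exists>i. F \<subseteq> C i"
  using assms(2,3)
proof (induction F)
  case (insert x F)
  then obtain i j where ij: "F \<subseteq> C i" "x \<in> C j" by auto
  have "C i \<subseteq> C (max i j)" "C j \<subseteq> C (max i j)"
    using lift_Suc_mono_le[of C] inc by simp_all
  then show ?case using ij by (intro exI[of _ "max i j"]) blast
qed simp

text \<open>\<open>G C\<close> collects the selections, for all radii \<open>m\<close> and
  precisions \<open>1 / (k + 1)\<close>, at nonempty polytopes with data in the rational span of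
  \<open>C\<close>. Finiteness of the data gives countability and compatibility with increasing
  unions, approximation gives both density conditions, and perturbation makes \<open>G C\<close>
  depend only on the closed span.\<close>

lemma asplund_generator_exists:
  assumes asplund: "asplund_space TYPE('a::banach)"
  shows "\<exists>G :: 'a::banach set \<Rightarrow> ('a \<Rightarrow>\<^sub>L real) set. asplund_generator G"
proof -
  have "\<exists>sel :: ('a \<Rightarrow>\<^sub>L real) set \<Rightarrow> ('a \<Rightarrow>\<^sub>L real). weak_star_selector (real m) (1 / real (Suc k)) sel" for m k
    using weak_star_selector_exists[OF asplund, of "real m" "1 / real (Suc k)"] by auto
  then obtain sel :: "nat \<Rightarrow> nat \<Rightarrow> ('a \<Rightarrow>\<^sub>L real) set \<Rightarrow> ('a \<Rightarrow>\<^sub>L real)"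
    where sel: "\<And>m k. weak_star_selector (real m) (1 / real (Suc k)) (sel m k)"
    by metis
  define I where "I C = {F :: ('a \<times> rat) set. finite F \<and> F \<subseteq> rational_span C \<times> UNIV}" for C
  define G where "G C = (\<Union>m k. (\<lambda>F. sel m k (weak_star_polytope (real m) F)) `
    {F \<in> I C. weak_star_polytope (real m) F \<noteq> {}})" for C
  have G: "g \<in> G C \<longleftrightarrow> (\<exists>m k F. F \<in> I C \<and> weak_star_polytope (real m) F \<noteq> {} \<and>
      g = sel m k (weak_star_polytope (real m) F))" for g C
    by (auto simp: G_def)
  have I_mono: "I C \<subseteq> I D" if "C \<subseteq> D" for C D
    using rational_span_mono[OF that] by (auto simp: I_def)
  have I_Union: "I (\<Union>i. C i) = (\<Union>i. I (C i))" if inc: "\<And>i. C i \<subseteq> C (Suc i)" for C :: "nat \<Rightarrow> 'a set"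
  proof
    show "(\<Union>i. I (C i)) \<subseteq> I (\<Union>i. C i)" by (intro UN_least I_mono) auto
    show "I (\<Union>i. C i) \<subseteq> (\<Union>i. I (C i))"
    proof
      fix F assume F: "F \<in> I (\<Union>i. C i)"
      have "F \<subseteq> (\<Union>i. rational_span (C i) \<times> UNIV)"
        using F rational_span_incseq_Union[of C, OF inc] by (auto simp: I_def)
      then have "\<exists>i. F \<subseteq> rational_span (C i) \<times> UNIV"
        using F by (intro finite_subset_incseq_Union) (auto simp: I_def dest: rational_span_mono[OF inc, THEN subsetD])
      then show "F \<in> (\<Union>i. I (C i))" using F by (auto simp: I_def)
    qed
  qed
  \<comment> \<open>This serves both density conditions: with \<open>C\<close> itself for
    functionals on \<open>closed_span C\<close>, and with \<open>UNIV\<close> for the whole dual.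
    Naming \<open>F\<close> records the finite data on which \<open>g\<close> depends.\<close>
  have approx: "\<exists>g y F. F \<in> I C \<and> (\<forall>C'. F \<in> I C' \<longrightarrow> g \<in> G C') \<and>
      (\<forall>x\<in>closed_span C. blinfun_apply y x = blinfun_apply y0 x) \<and> dist g y < e"
    if e: "e > 0" for y0 :: "'a \<Rightarrow>\<^sub>L real" and C e
  proof -
    obtain m where m: "norm y0 \<le> real m" using real_arch_simple by blast
    obtain k where k: "1 / real (Suc k) < e" using nat_approx_posE[OF e] by blast
    obtain F y where F: "finite F" "F \<subseteq> rational_span C \<times> UNIV" "y0 \<in> weak_star_polytope (real m) F"
      and y: "\<And>x. x \<in> closed_span C \<Longrightarrow> blinfun_apply y x = blinfun_apply y0 x"
      "dist (sel m k (weak_star_polytope (real m) F)) y \<le> 1 / real (Suc k)"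
      using selector_approximation[OF sel m] by blast
    show ?thesis
    proof (intro exI conjI allI impI ballI)
      show "F \<in> I C" using F by (simp add: I_def)
      show "sel m k (weak_star_polytope (real m) F) \<in> G C'" if "F \<in> I C'" for C'
        using that F(3) unfolding G by blast
      show "blinfun_apply y x = blinfun_apply y0 x" if "x \<in> closed_span C" for x
        using y(1)[OF that] .
      show "dist (sel m k (weak_star_polytope (real m) F)) y < e" using y(2) k by linarith
    qed
  qed
  have G_subset: "G C1 \<subseteq> G C2" if eq: "closed_span C1 = closed_span C2" for C1 C2
  proof
    fix g assume "g \<in> G C1"
    then obtain m k F where F: "F \<in> I C1" "weak_star_polytope (real m) F \<noteq> {}"
      "g = sel m k (weak_star_polytope (real m) F)"
      unfolding G by blast
    have "F \<subseteq> closed_span C2 \<times> UNIV"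
      using F(1) closure_subset[of "rational_span C1"] eq unfolding closure_rational_span I_def by blast
    then obtain F' where F': "finite F'" "F' \<subseteq> rational_span C2 \<times> UNIV" "weak_star_polytope (real m) F' \<noteq> {}"
      "sel m k (weak_star_polytope (real m) F') = sel m k (weak_star_polytope (real m) F)"
      using selector_perturbation[OF sel, of m F C2 k] F(1,2) by (auto simp: I_def)
    then have "F' \<in> I C2" by (simp add: I_def)
    then show "g \<in> G C2" using F(3) F'(3,4) unfolding G by metis
  qed
  have "asplund_generator G"
    unfolding asplund_generator_def
  proof (intro conjI allI impI)
    fix C :: "'a set" assume C: "countable C"
    have "countable (I C)"
      using countable_Collect_finite_subset[of "rational_span C \<times> (UNIV :: rat set)"] countable_rational_span[OF C]
      by (simp add: I_def)
    then have "countable {F \<in> I C. weak_star_polytope (real m) F \<noteq> {}}" for m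
      by (rule countable_subset[rotated]) auto
    then show "countable (G C)" unfolding G_def by auto
    show "subspace_dual (closed_span C) \<subseteq>
        subspace_dual_closure (closed_span C) (restrict_functional (closed_span C) ` G C)"
    proof
      fix f assume f: "f \<in> subspace_dual (closed_span C)"
      obtain y0 where y0: "restrict_functional (closed_span C) y0 = f"
        using restrict_functional_onto[OF subspace_closed_span f] by blast
      have "\<exists>g\<in>restrict_functional (closed_span C) ` G C. subspace_dual_dist (closed_span C) g f < e"
        if e: "e > 0" for e
      proof -
        have "e / 2 > 0" using e by simp
        from approx[OF this, of C y0] obtain g y where g: "g \<in> G C" "dist g y < e / 2"
          and y: "\<And>x. x \<in> closed_span C \<Longrightarrow> blinfun_apply y x = blinfun_apply y0 x"
          by blast
        have "\<bar>blinfun_apply g h - blinfun_apply y0 h\<bar> \<le> e / 2 * norm h" if "h \<in> closed_span C" for h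
        proof -
          have "\<bar>blinfun_apply g h - blinfun_apply y0 h\<bar> \<le> dist g y * norm h"
            using norm_blinfun[of "g - y" h] y[OF that] by (simp add: blinfun.diff_left dist_norm)
          also have "\<dots> \<le> e / 2 * norm h" using g(2) by (intro mult_right_mono) auto
          finally show ?thesis .
        qed
        then have "subspace_dual_dist (closed_span C) (restrict_functional (closed_span C) g)
            (restrict_functional (closed_span C) y0) \<le> e / 2"
          using e by (subst subspace_dual_dist_le_iff[OF subspace_closed_span]) auto
        then show ?thesis using g(1) y0 e by force
      qed
      then show "f \<in> subspace_dual_closure (closed_span C) (restrict_functional (closed_span C) ` G C)"
        using f by (simp add: subspace_dual_closure_def)
    qed
  next
    fix C :: "nat \<Rightarrow> 'a set" assume "(\<forall>i. countable (C i)) \<and> (\<forall>i. C i \<subseteq> C (Suc i))"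
    then have IC: "I (\<Union>i. C i) = (\<Union>i. I (C i))" using I_Union by blast
    have "g \<in> G (\<Union>i. C i) \<longleftrightarrow> (\<exists>i. g \<in> G (C i))" for g
      unfolding G IC UN_iff by fast
    then show "G (\<Union>i. C i) = (\<Union>i. G (C i))" by blast
  next
    have "y0 \<in> closure (\<Union>{G C |C. countable C})" for y0 :: "'a \<Rightarrow>\<^sub>L real"
      unfolding closure_approachable
    proof (intro allI impI)
      fix e :: real assume e: "e > 0"
      \<comment> \<open>Over the whole space \<open>y\<close> equals \<open>y0\<close>, and the
        finitely many points occurring in \<open>F\<close> already form a countable set whose
        \<open>G\<close> contains \<open>g\<close>.\<close>
      from approx[OF e, of UNIV y0] obtain g y F where F: "F \<in> I UNIV" "\<And>C'. F \<in> I C' \<Longrightarrow> g \<in> G C'"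
        and y: "\<And>x. x \<in> closed_span UNIV \<Longrightarrow> blinfun_apply y x = blinfun_apply y0 x" "dist g y < e"
        by blast
      have "y = y0"
        by (rule blinfun_eqI) (use y(1) closed_span_superset[of UNIV] in blast)
      moreover have "F \<subseteq> rational_span (fst ` F) \<times> UNIV"
        using rational_span_superset[of "fst ` F"] by force
      then have "g \<in> G (fst ` F)" using F by (simp add: I_def)
      moreover have "countable (fst ` F)" using F(1) by (simp add: I_def countable_finite)
      ultimately show "\<exists>g\<in>\<Union>{G C |C. countable C}. dist g y0 < e" using y(2) by blast
    qed
    then show "closure (\<Union>{G C |C. countable C}) = UNIV" by blast
  next
    fix C1 C2 :: "'a set"
    assume "countable C1 \<and> countable C2 \<and> closed_span C1 = closed_span C2"
    then have "G C1 = G C2" using G_subset[of C1 C2] G_subset[of C2 C1] by auto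
    then show "closed_span (G C1) = closed_span (G C2)" by simp
  qed
  then show ?thesis by blast
qed

subsection \<open>From a generator to a rich family\<close>

lemma closed_span_incseq_Union:
  fixes C :: "nat \<Rightarrow> 'a::real_normed_vector set"
  assumes inc: "\<And>i. C i \<subseteq> C (Suc i)"
  shows "closed_span (\<Union>i. C i) = closure (\<Union>i. closed_span (C i))"
proof
  have "(\<Union>i. rational_span (C i)) \<subseteq> (\<Union>i. closed_span (C i))"
    using closure_subset by (fastforce simp flip: closure_rational_span)
  then have "closure (\<Union>i. rational_span (C i)) \<subseteq> closure (\<Union>i. closed_span (C i))"
    by (rule closure_mono)
  then show "closed_span (\<Union>i. C i) \<subseteq> closure (\<Union>i. closed_span (C i))"
    by (simp add: rational_span_incseq_Union[of C, OF inc] flip: closure_rational_span)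
  show "closure (\<Union>i. closed_span (C i)) \<subseteq> closed_span (\<Union>i. C i)"
    by (intro closure_minimal closed_closed_span UN_least closed_span_mono) auto
qed

text \<open>Both the distance of two functionals and that of their restrictions depend continuously
  on the functionals.\<close>

lemma restriction_isometric_closure:
  assumes V: "subspace V" and S: "restriction_isometric V S" and Y: "Y \<subseteq> closure S"
  shows "restriction_isometric V Y"
proof (rule restriction_isometricI[OF V])
  fix y1 y2 e assume y: "y1 \<in> Y" "y2 \<in> Y" and e: "0 \<le> e"
    and le: "\<And>h. h \<in> V \<Longrightarrow> \<bar>blinfun_apply y1 h - blinfun_apply y2 h\<bar> \<le> e * norm h"
  show "dist y1 y2 \<le> e"
  proof (rule field_le_epsilon)
    fix \<eta> :: real assume \<eta>: "\<eta> > 0"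
    \<comment> \<open>The two approximation errors enter twice: in the estimate on \<open>V\<close>
      and in the final triangle inequality.\<close>
    then have "\<eta> / 4 > 0" by simp
    then obtain s1 s2 where s: "s1 \<in> S" "dist s1 y1 < \<eta> / 4" "s2 \<in> S" "dist s2 y2 < \<eta> / 4"
      using y Y closure_approachable by (metis subsetD)
    have near: "\<bar>blinfun_apply s h - blinfun_apply y h\<bar> \<le> \<eta> / 4 * norm h" if "dist s y < \<eta> / 4" for s y h
    proof -
      have "\<bar>blinfun_apply s h - blinfun_apply y h\<bar> \<le> dist s y * norm h"
        using norm_blinfun[of "s - y" h] by (simp add: blinfun.diff_left dist_norm)
      also have "\<dots> \<le> \<eta> / 4 * norm h" using that by (intro mult_right_mono) auto
      finally show ?thesis .
    qed
    have "\<bar>blinfun_apply s1 h - blinfun_apply s2 h\<bar> \<le> (e + \<eta> / 2) * norm h" if "h \<in> V" for h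
    proof -
      have "\<bar>blinfun_apply s1 h - blinfun_apply s2 h\<bar> \<le> \<eta> / 4 * norm h + e * norm h + \<eta> / 4 * norm h"
        using near[OF s(2), of h] near[OF s(4), of h] le[OF that] by linarith
      then show ?thesis by (simp add: algebra_simps)
    qed
    then have "dist s1 s2 \<le> e + \<eta> / 2"
      using e \<eta> by (intro restriction_isometricD[OF S V s(1,3)]) auto
    then show "dist y1 y2 \<le> e + \<eta>"
      using s dist_triangle[of y1 y2 s1] dist_triangle[of s1 y2 s2] dist_commute[of y1 s1] by linarith
  qed
qed

text \<open>Countably many points determine the norm: for each rational \<open>q\<close> below it,
  one point at which \<open>y\<close> exceeds slope \<open>q\<close>.\<close>

lemma norming_points:
  fixes y :: "'a::real_normed_vector \<Rightarrow>\<^sub>L real"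
  shows "\<exists>N :: rat \<Rightarrow> 'a. \<forall>e\<ge>0. (\<forall>q. \<bar>blinfun_apply y (N q)\<bar> \<le> e * norm (N q)) \<longrightarrow> norm y \<le> e"
proof -
  have "\<exists>h. 0 \<le> real_of_rat q \<and> real_of_rat q < norm y \<longrightarrow>
      real_of_rat q * norm h < \<bar>blinfun_apply y h\<bar>" for q
    using norm_blinfun_bound[of "real_of_rat q" y] by (auto simp: not_less[symmetric])
  then obtain N where N: "\<And>q. 0 \<le> real_of_rat q \<Longrightarrow> real_of_rat q < norm y \<Longrightarrow>
      real_of_rat q * norm (N q) < \<bar>blinfun_apply y (N q)\<bar>"
    by metis
  show ?thesis
  proof (intro exI[of _ N] allI impI, rule ccontr)
    fix e :: real assume e: "0 \<le> e" "\<forall>q. \<bar>blinfun_apply y (N q)\<bar> \<le> e * norm (N q)" "\<not> norm y \<le> e"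
    obtain r where "r \<in> \<rat>" "e < r" "r < norm y"
      using Rats_dense_in_real[of e "norm y"] e(3) by auto
    then obtain q where q: "e < real_of_rat q" "real_of_rat q < norm y" by (auto elim: Rats_cases)
    have "e * norm (N q) \<le> real_of_rat q * norm (N q)" using q by (intro mult_right_mono) auto
    moreover have "\<bar>blinfun_apply y (N q)\<bar> \<le> e * norm (N q)" using e(2) by blast
    ultimately show False using N[of q] q e(1) by linarith
  qed
qed

text \<open>Isometry makes a sequence in \<open>S\<close> Cauchy as soon as its restrictions
  converge to \<open>f\<close>. The limit exists by completeness of the dual, lies in the closed set
  \<open>Y\<close> and restricts to \<open>f\<close>.\<close>

lemma restriction_surjective_if_dense:
  fixes V :: "'a::banach set"
  assumes V: "subspace V" and Y: "closed Y" "S \<subseteq> Y" and iso: "restriction_isometric V Y"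
    and dense: "subspace_dual V \<subseteq> subspace_dual_closure V (restrict_functional V ` S)"
  shows "restriction_surjective V Y"
  unfolding restriction_surjective_def
proof
  show "restrict_functional V ` Y \<subseteq> subspace_dual V"
    using restrict_functional_in_subspace_dual[OF V] by blast
  show "subspace_dual V \<subseteq> restrict_functional V ` Y"
  proof
    fix f assume f: "f \<in> subspace_dual V"
    obtain y0 where y0: "restrict_functional V y0 = f"
      using restrict_functional_onto[OF V f] by blast
    have "\<exists>g\<in>S. subspace_dual_dist V (restrict_functional V g) f < 1 / real (Suc n)" for n
    proof -
      have "f \<in> subspace_dual_closure V (restrict_functional V ` S)" using f dense by blast
      then show ?thesis unfolding subspace_dual_closure_def by simp
    qed
    then obtain g where g: "\<And>n. g n \<in> S" "\<And>n. subspace_dual_dist V (restrict_functional V (g n)) f < 1 / real (Suc n)"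
      by metis
    have gy0: "\<bar>blinfun_apply (g n) h - blinfun_apply y0 h\<bar> \<le> 1 / real (Suc n) * norm h" if "h \<in> V" for n h
      using g(2)[of n] that y0 subspace_dual_dist_le_iff[OF V, of "1 / real (Suc n)" "g n" y0] by auto
    have dist_g: "dist (g m) (g n) \<le> 1 / real (Suc m) + 1 / real (Suc n)" for m n
    proof (rule restriction_isometricD[OF iso V])
      show "g m \<in> Y" "g n \<in> Y" using g(1) Y(2) by auto
      fix h assume h: "h \<in> V"
      show "\<bar>blinfun_apply (g m) h - blinfun_apply (g n) h\<bar> \<le> (1 / real (Suc m) + 1 / real (Suc n)) * norm h"
        unfolding distrib_right using gy0[OF h, of m] gy0[OF h, of n] by linarith
    qed simp
    have "Cauchy g"
      unfolding Cauchy_def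
    proof (intro allI impI)
      fix e :: real assume "e > 0"
      then obtain M where M: "1 / real (Suc M) < e / 2" using nat_approx_posE half_gt_zero by metis
      have "1 / real (Suc n) \<le> 1 / real (Suc M)" if "n \<ge> M" for n
        using that by (simp add: frac_le)
      then have "dist (g m) (g n) < e" if "m \<ge> M" "n \<ge> M" for m n
        using dist_g[of m n] that M by (smt (verit) field_sum_of_halves)
      then show "\<exists>M. \<forall>m\<ge>M. \<forall>n\<ge>M. dist (g m) (g n) < e" by blast
    qed
    then obtain y where y: "g \<longlonglongrightarrow> y" using Cauchy_convergent convergent_def by blast
    then have "y \<in> Y" using Y g(1) closed_sequentially by blast
    moreover have "blinfun_apply y h = blinfun_apply y0 h" if h: "h \<in> V" for h
    proof (rule LIMSEQ_unique)
      show "(\<lambda>n. blinfun_apply (g n) h) \<longlonglongrightarrow> blinfun_apply y h"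
        using y by (intro tendsto_intros)
      have "(\<lambda>n. 1 / real (Suc n) * norm h) \<longlonglongrightarrow> 0"
        using tendsto_mult_right[OF LIMSEQ_inverse_real_of_nat, of "norm h"] by (simp add: inverse_eq_divide)
      then have "(\<lambda>n. blinfun_apply (g n) h - blinfun_apply y0 h) \<longlonglongrightarrow> 0"
        by (rule Lim_null_comparison[rotated]) (use gy0[OF h] in \<open>auto intro!: always_eventually\<close>)
      then show "(\<lambda>n. blinfun_apply (g n) h) \<longlonglongrightarrow> blinfun_apply y0 h"
        by (rule LIM_zero_cancel)
    qed
    then have "restrict_functional V y = restrict_functional V y0"
      unfolding restrict_functional_def by (intro restrict_ext)
    then have "restrict_functional V y = f" by (simp add: y0)
    ultimately show "f \<in> restrict_functional V ` Y" by blast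
  qed
qed

section \<open>The rectangle family of a generator\<close>

context
  fixes G :: "'a::banach set \<Rightarrow> ('a \<Rightarrow>\<^sub>L real) set"
  assumes G: "asplund_generator G"
begin

lemma generator_countable: "countable C \<Longrightarrow> countable (G C)"
  using G by (simp add: asplund_generator_def)

lemma generator_Union:
  fixes C :: "nat \<Rightarrow> 'a set"
  shows "(\<And>i. countable (C i)) \<Longrightarrow> (\<And>i. C i \<subseteq> C (Suc i)) \<Longrightarrow> G (\<Union>i. C i) = (\<Union>i. G (C i))"
  using G unfolding asplund_generator_def by blast

lemma generator_closed_span:
  "countable C1 \<Longrightarrow> countable C2 \<Longrightarrow> closed_span C1 = closed_span C2 \<Longrightarrow>
    closed_span (G C1) = closed_span (G C2)"
  using G unfolding asplund_generator_def by blast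

text \<open>The union condition, applied to the sequence \<open>C1, C2, C2, ...\<close>.\<close>

lemma generator_mono:
  assumes "countable C2" "C1 \<subseteq> C2"
  shows "G C1 \<subseteq> G C2"
proof -
  define C where "C i = (if i = 0 then C1 else C2)" for i :: nat
  have "countable (C i)" "C i \<subseteq> C (Suc i)" for i
    using assms countable_subset by (auto simp: C_def)
  then have "G (\<Union>i. C i) = (\<Union>i. G (C i))" by (rule generator_Union)
  moreover have "(\<Union>i. C i) = C2"
    using assms(2) by (auto simp: C_def split: if_splits)
  moreover have "G (C 0) \<subseteq> (\<Union>i. G (C i))" by blast
  ultimately show ?thesis by (simp add: C_def)
qed

text \<open>Isometry is imposed by selection. Surjectivity then follows from density of the
  restrictions, and the work goes into showing that enough rectangles remain.\<close>

definition generated_family :: "('a \<times> ('a \<Rightarrow>\<^sub>L real)) set set" where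
  "generated_family = {closed_span C \<times> closed_span (G C) |C.
     countable C \<and> restriction_isometric (closed_span C) (closed_span (G C))}"

text \<open>A rectangle determines its factors because both contain 0.\<close>

lemma generated_familyE:
  assumes "V \<times> Y \<in> generated_family"
  obtains C where "countable C" "V = closed_span C" "Y = closed_span (G C)" "restriction_isometric V Y"
proof -
  obtain C where C: "V \<times> Y = closed_span C \<times> closed_span (G C)" "countable C"
    "restriction_isometric (closed_span C) (closed_span (G C))"
    using assms by (auto simp: generated_family_def)
  have "0 \<in> closed_span C" "0 \<in> closed_span (G C)"
    using subspace_closed_span subspace_0 by blast+
  then have "V = closed_span C" "Y = closed_span (G C)"
    using C(1) by (auto simp: times_eq_iff)
  then show thesis using that C by blast
qed

text \<open>If \<open>V1 \<subseteq> V2\<close>, then \<open>C1 \<union> C2\<close> and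
  \<open>C2\<close> have the same closed span, so both generate \<open>Y2\<close>; and
  \<open>G (C1 \<union> C2)\<close> contains \<open>G C1\<close>.\<close>

lemma generated_family_monotone:
  assumes "V1 \<times> Y1 \<in> generated_family" "V2 \<times> Y2 \<in> generated_family" "V1 \<subseteq> V2"
  shows "Y1 \<subseteq> Y2"
proof -
  obtain C1 where C1: "countable C1" "V1 = closed_span C1" "Y1 = closed_span (G C1)"
    using assms(1) by (rule generated_familyE)
  obtain C2 where C2: "countable C2" "V2 = closed_span C2" "Y2 = closed_span (G C2)"
    using assms(2) by (rule generated_familyE)
  have "C1 \<union> C2 \<subseteq> closed_span C2"
    using closed_span_superset[of C1] closed_span_superset[of C2] assms(3) C1 C2 by blast
  then have "closed_span (C1 \<union> C2) = closed_span C2"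
    by (intro antisym closed_span_minimal closed_span_mono subspace_closed_span closed_closed_span) auto
  then have "closed_span (G (C1 \<union> C2)) = Y2"
    using generator_closed_span[of "C1 \<union> C2" C2] C1 C2 by simp
  moreover have "Y1 \<subseteq> closed_span (G (C1 \<union> C2))"
    unfolding C1 using C1 C2 by (intro closed_span_mono generator_mono) auto
  ultimately show ?thesis by simp
qed

lemma generated_family_surjective:
  assumes "V \<times> Y \<in> generated_family"
  shows "restriction_surjective V Y"
proof -
  obtain C where C: "countable C" "V = closed_span C" "Y = closed_span (G C)" "restriction_isometric V Y"
    using assms by (rule generated_familyE)
  have "subspace_dual V \<subseteq> subspace_dual_closure V (restrict_functional V ` G C)"
    unfolding C(2) using G C(1) by (simp add: asplund_generator_def)
  then show ?thesis
    using C closed_span_superset[of "G C"]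
    by (intro restriction_surjective_if_dense[of V Y "G C"])
      (simp_all add: subspace_closed_span closed_closed_span)
qed

text \<open>Two elements of the union of the \<open>Y i\<close> lie in a common \<open>Y i\<close>,
  where \<open>V i\<close> already measures their distance. Isometry therefore holds on the union
  and passes to its closure.\<close>

lemma sigma_complete_generated_family: "sigma_complete_family generated_family"
  unfolding sigma_complete_family_def
proof (intro allI impI, elim conjE)
  fix V :: "nat \<Rightarrow> 'a set" and Y :: "nat \<Rightarrow> ('a \<Rightarrow>\<^sub>L real) set"
  assume VY: "\<forall>i. V i \<times> Y i \<in> generated_family"
    and inc: "\<forall>i. V i \<times> Y i \<subseteq> V (Suc i) \<times> Y (Suc i)"
  have "\<exists>C. countable C \<and> V i = closed_span C \<and> Y i = closed_span (G C) \<and> restriction_isometric (V i) (Y i)" for i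
    using generated_familyE[of "V i" "Y i"] VY by metis
  then obtain C where C: "\<And>i. countable (C i)" "\<And>i. V i = closed_span (C i)"
    "\<And>i. Y i = closed_span (G (C i))" "\<And>i. restriction_isometric (V i) (Y i)"
    by metis
  have zero: "0 \<in> V i" "0 \<in> Y i" for i
    using C(2,3) subspace_closed_span subspace_0 by metis+
  have incV: "V i \<subseteq> V (Suc i)" and incY: "Y i \<subseteq> Y (Suc i)" for i
    using inc zero by blast+
  have V_mono: "V i \<subseteq> V j" and Y_mono: "Y i \<subseteq> Y j" if "i \<le> j" for i j
    using lift_Suc_mono_le[of V, OF incV that] lift_Suc_mono_le[of Y, OF incY that] by auto
  \<comment> \<open>The sets \<open>C i\<close> need not increase. Their partial unions do, with the
    same closed spans, and by invariance they generate the same \<open>Y i\<close>.\<close>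
  define D where "D i = (\<Union>j\<le>i. C j)" for i
  have D: "countable (D i)" "D i \<subseteq> D (Suc i)" "C i \<subseteq> D i" for i
    using C(1) by (auto simp: D_def intro: le_SucI)
  have "D i \<subseteq> V i" for i
    using closed_span_superset V_mono C(2) unfolding D_def by (metis UN_least atMost_iff order_trans)
  then have VD: "closed_span (D i) = V i" for i
    using closed_span_mono[OF D(3), of i] C(2)[of i]
    by (metis antisym closed_closed_span closed_span_minimal subspace_closed_span)
  have YD: "closed_span (G (D i)) = Y i" for i
    using generator_closed_span[OF D(1) C(1)] VD C(2,3) by metis
  have GD: "G (\<Union>i. D i) = (\<Union>i. G (D i))"
    using D by (intro generator_Union)
  have V': "closed_span (\<Union>i. D i) = closure (\<Union>i. V i)"
    using closed_span_incseq_Union[of D, OF D(2)] VD by simp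
  have Y': "closed_span (G (\<Union>i. D i)) = closure (\<Union>i. Y i)"
    unfolding GD using closed_span_incseq_Union[of "\<lambda>i. G (D i)"] generator_mono D YD by simp
  have "restriction_isometric (closed_span (\<Union>i. D i)) (\<Union>i. Y i)"
  proof (rule restriction_isometricI[OF subspace_closed_span])
    fix y1 y2 e assume y: "y1 \<in> (\<Union>i. Y i)" "y2 \<in> (\<Union>i. Y i)" and e: "0 \<le> e"
      and le: "\<And>h. h \<in> closed_span (\<Union>i. D i) \<Longrightarrow> \<bar>blinfun_apply y1 h - blinfun_apply y2 h\<bar> \<le> e * norm h"
    obtain i j where "y1 \<in> Y i" "y2 \<in> Y j" using y by blast
    then have ym: "y1 \<in> Y (max i j)" "y2 \<in> Y (max i j)"
      using Y_mono[of i "max i j"] Y_mono[of j "max i j"] by auto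
    have sub: "V (max i j) \<subseteq> closed_span (\<Union>i. D i)"
      unfolding V' using closure_subset[of "\<Union>i. V i"] by blast
    show "dist y1 y2 \<le> e"
    proof (rule restriction_isometricD[OF C(4) _ ym e])
      show "subspace (V (max i j))" unfolding C(2) by (rule subspace_closed_span)
      show "\<bar>blinfun_apply y1 h - blinfun_apply y2 h\<bar> \<le> e * norm h" if "h \<in> V (max i j)" for h
        using that sub by (intro le) blast
    qed
  qed
  then have "restriction_isometric (closed_span (\<Union>i. D i)) (closed_span (G (\<Union>i. D i)))"
    by (rule restriction_isometric_closure[OF subspace_closed_span]) (simp add: Y')
  moreover have "countable (\<Union>i. D i)" using D(1) by simp
  ultimately show "closure (\<Union>i. V i) \<times> closure (\<Union>i. Y i) \<in> generated_family"
    unfolding V'[symmetric] Y'[symmetric] generated_family_def by blast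
qed

text \<open>Start from a countable set large enough to capture both factors, then add norming points
  for the functionals generated so far until nothing new arises.\<close>

lemma cofinal_generated_family: "cofinal_family generated_family"
  unfolding cofinal_family_def
proof
  fix W :: "('a \<times> ('a \<Rightarrow>\<^sub>L real)) set" assume "W \<in> separable_rectangles"
  then obtain V0 Y0 where W: "W = V0 \<times> Y0" and V0: "V0 \<in> separable_closed_subspaces"
    and Y0: "Y0 \<in> separable_closed_subspaces"
    by (auto simp: separable_rectangles_def)
  obtain D1 where D1: "countable D1" "V0 \<subseteq> closure D1"
    using separable_closed_subspaceE[OF V0] by metis
  obtain D2 where D2: "countable D2" "Y0 \<subseteq> closure D2"
    using separable_closed_subspaceE[OF Y0] by metis
  have "\<exists>C. countable C \<and> (\<exists>g\<in>G C. dist g y < 1 / real (Suc n))" for y n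
  proof -
    have "y \<in> closure (\<Union>{G C |C. countable C})"
      using G by (simp add: asplund_generator_def)
    then have "\<exists>g\<in>\<Union>{G C |C. countable C}. dist g y < 1 / real (Suc n)"
      unfolding closure_approachable by simp
    then show ?thesis by blast
  qed
  then obtain c where c: "\<And>y n. countable (c y n)" "\<And>y n. \<exists>g\<in>G (c y n). dist g y < 1 / real (Suc n)"
    by metis
  \<comment> \<open>\<open>D1\<close> takes care of \<open>V0\<close>. The sets \<open>c y n\<close>
    put points within \<open>1 / (n + 1)\<close> of each \<open>y\<close> in \<open>D2\<close> into
    \<open>G C\<close>, by monotonicity of \<open>G\<close>.\<close>
  define C0 where "C0 = D1 \<union> (\<Union>y\<in>D2. \<Union>n. c y n)"
  have C0: "countable C0"
    using D1 D2 c(1) by (auto simp: C0_def)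
  obtain N :: "('a \<Rightarrow>\<^sub>L real) \<Rightarrow> rat \<Rightarrow> 'a" where
    N: "\<And>y e. 0 \<le> e \<Longrightarrow> (\<And>q. \<bar>blinfun_apply y (N y q)\<bar> \<le> e * norm (N y q)) \<Longrightarrow> norm y \<le> e"
    using norming_points by metis
  obtain C where C: "countable C" "C0 \<subseteq> C" "(\<Union>y\<in>rational_span (G C). range (N y)) \<subseteq> C"
  proof (rule closing_off[of "\<lambda>C. \<Union>y\<in>rational_span (G C). range (N y)" C0])
    show "countable (\<Union>y\<in>rational_span (G C). range (N y))" if "countable C" for C
      using that by (auto intro: countable_rational_span generator_countable)
    show "(\<Union>y\<in>rational_span (G (\<Union>i. C i)). range (N y)) \<subseteq> (\<Union>i. \<Union>y\<in>rational_span (G (C i)). range (N y))"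
      if "\<And>i. countable (C i)" "\<And>i. C i \<subseteq> C (Suc i)" for C :: "nat \<Rightarrow> 'a set"
      using that rational_span_incseq_Union[of "\<lambda>i. G (C i)"]
      by (simp add: generator_Union generator_mono)
  qed (rule C0)
  have "restriction_isometric (closed_span C) (rational_span (G C))"
  proof (rule restriction_isometricI[OF subspace_closed_span])
    fix y1 y2 e assume y: "y1 \<in> rational_span (G C)" "y2 \<in> rational_span (G C)" and e: "0 \<le> e"
      and le: "\<And>h. h \<in> closed_span C \<Longrightarrow> \<bar>blinfun_apply y1 h - blinfun_apply y2 h\<bar> \<le> e * norm h"
    \<comment> \<open>Differences stay in the rational span, so the norming points of
      \<open>y1 - y2\<close> belong to \<open>C\<close>.\<close>
    have "y1 + real_of_rat (-1) *\<^sub>R y2 \<in> rational_span (G C)"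
      using y by (intro rational_span_add rational_span_scale)
    then have "y1 - y2 \<in> rational_span (G C)" by simp
    then have "N (y1 - y2) q \<in> closed_span C" for q
      using C(3) closed_span_superset by blast
    then have "norm (y1 - y2) \<le> e"
      using le by (intro N[OF e]) (simp add: blinfun.diff_left)
    then show "dist y1 y2 \<le> e" by (simp add: dist_norm)
  qed
  then have "restriction_isometric (closed_span C) (closed_span (G C))"
    by (rule restriction_isometric_closure[OF subspace_closed_span]) (simp add: closure_rational_span)
  then have "closed_span C \<times> closed_span (G C) \<in> generated_family"
    using C(1) by (auto simp: generated_family_def)
  moreover have "V0 \<subseteq> closed_span C"
  proof -
    have "closure D1 \<subseteq> closed_span C"
      using C(2) closed_span_superset[of C] by (intro closure_minimal closed_closed_span) (auto simp: C0_def)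
    then show ?thesis using D1 by blast
  qed
  moreover have "Y0 \<subseteq> closed_span (G C)"
  proof -
    have "y \<in> closure (G C)" if y: "y \<in> D2" for y
      unfolding closure_approachable
    proof (intro allI impI)
      fix e :: real assume "e > 0"
      then obtain n where n: "1 / real (Suc n) < e" using nat_approx_posE by blast
      obtain g where g: "g \<in> G (c y n)" "dist g y < 1 / real (Suc n)" using c(2) by blast
      have "c y n \<subseteq> C" using y C(2) unfolding C0_def by blast
      then have "g \<in> G C" using g(1) generator_mono[OF C(1)] by blast
      then show "\<exists>g\<in>G C. dist g y < e" using g(2) n by force
    qed
    moreover have "closure (G C) \<subseteq> closed_span (G C)"
      by (intro closure_minimal closed_closed_span closed_span_superset)
    ultimately have "closure D2 \<subseteq> closed_span (G C)"
      by (intro closure_minimal closed_closed_span) blast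
    then show ?thesis using D2 by blast
  qed
  ultimately show "\<exists>W'\<in>generated_family. W \<subseteq> W'"
    unfolding W by (intro bexI[of _ "closed_span C \<times> closed_span (G C)"] Sigma_mono)
qed

lemma rectangle_generated_family: "rectangle_family generated_family"
  unfolding rectangle_family_def
proof
  fix W assume "W \<in> generated_family"
  then obtain C where "W = closed_span C \<times> closed_span (G C)" "countable C"
    by (auto simp: generated_family_def)
  then show "W \<in> separable_rectangles"
    unfolding separable_rectangles_def
    using closed_span_separable[of C] closed_span_separable[of "G C"] generator_countable by blast
qed

end

section \<open>Equivalence of the four assertions\<close>

theorem theorem2p3:
  shows
    "(asplund_space TYPE('a::banach)
        \<longleftrightarrow> (\<exists>G :: 'a set \<Rightarrow> ('a \<Rightarrow>\<^sub>L real) set. asplund_generator G)) \<and>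
     ((\<exists>G :: 'a set \<Rightarrow> ('a \<Rightarrow>\<^sub>L real) set. asplund_generator G)
        \<longleftrightarrow> (\<exists>A :: ('a \<times> ('a \<Rightarrow>\<^sub>L real)) set set.
              rectangle_family A \<and> rich_family A \<and>
              (\<forall>V1 Y1 V2 Y2. V1 \<times> Y1 \<in> A \<and> V2 \<times> Y2 \<in> A \<and> V1 \<subseteq> V2 \<longrightarrow> Y1 \<subseteq> Y2) \<and>
              (\<forall>V Y. V \<times> Y \<in> A \<longrightarrow> restriction_surjective V Y \<and> restriction_isometric V Y))) \<and>
     ((\<exists>A :: ('a \<times> ('a \<Rightarrow>\<^sub>L real)) set set.
              rectangle_family A \<and> rich_family A \<and>
              (\<forall>V1 Y1 V2 Y2. V1 \<times> Y1 \<in> A \<and> V2 \<times> Y2 \<in> A \<and> V1 \<subseteq> V2 \<longrightarrow> Y1 \<subseteq> Y2) \<and>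
              (\<forall>V Y. V \<times> Y \<in> A \<longrightarrow> restriction_surjective V Y \<and> restriction_isometric V Y))
        \<longleftrightarrow> (\<exists>A :: ('a \<times> ('a \<Rightarrow>\<^sub>L real)) set set.
              rectangle_family A \<and> cofinal_family A \<and>
              (\<forall>V Y. V \<times> Y \<in> A \<longrightarrow> restriction_surjective V Y)))"
  (is "(?i \<longleftrightarrow> ?ii) \<and> (?ii \<longleftrightarrow> ?iii) \<and> (?iii \<longleftrightarrow> ?iv)")
proof -
  have cycle: "(P \<longleftrightarrow> Q) \<and> (Q \<longleftrightarrow> R) \<and> (R \<longleftrightarrow> S)"
    if "P \<Longrightarrow> Q" "Q \<Longrightarrow> R" "R \<Longrightarrow> S" "S \<Longrightarrow> P" for P Q R S
    using that by blast
  have 1: "?i \<Longrightarrow> ?ii" by (rule asplund_generator_exists)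
  have 2: ?iii if ?ii
  proof -
    obtain G :: "'a set \<Rightarrow> ('a \<Rightarrow>\<^sub>L real) set" where G: "asplund_generator G"
      using \<open>?ii\<close> by blast
    show ?iii
    proof (intro exI[of _ "generated_family G"] conjI allI impI)
      show "rectangle_family (generated_family G)"
        by (rule rectangle_generated_family[OF G])
      show "rich_family (generated_family G)"
        by (simp add: rich_family_def cofinal_generated_family[OF G] sigma_complete_generated_family[OF G])
      show "Y1 \<subseteq> Y2"
        if "V1 \<times> Y1 \<in> generated_family G \<and> V2 \<times> Y2 \<in> generated_family G \<and> V1 \<subseteq> V2" for V1 Y1 V2 Y2
        using that generated_family_monotone[OF G] by blast
      show "restriction_surjective V Y" if "V \<times> Y \<in> generated_family G" for V Y
        using that by (rule generated_family_surjective[OF G])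
      show "restriction_isometric V Y" if "V \<times> Y \<in> generated_family G" for V Y
        using that by (rule generated_familyE[OF G])
    qed
  qed
  have 3: "?iii \<Longrightarrow> ?iv"
    unfolding rich_family_def by (elim exE conjE, rule exI, intro conjI) (assumption | simp)+
  have 4: ?i if ?iv
  proof -
    obtain A :: "('a \<times> ('a \<Rightarrow>\<^sub>L real)) set set" where A: "rectangle_family A" "cofinal_family A"
      and surj: "\<forall>V Y. V \<times> Y \<in> A \<longrightarrow> restriction_surjective V Y"
      using \<open>?iv\<close> by (elim exE conjE)
    show ?i
      using A by (rule asplund_if_cofinal_surjective) (simp add: surj)
  qed
  show ?thesis
    using 1 2 3 4 by (rule cycle)
qed

end
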